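(* For any $m\in\{0,1,\dots\}$, any real $r$ and $x$, and any real-valued random variable $X$ with characteristic function $f$ such that $\mathsf{E}|X|^r<\infty$, $$\mathsf{E}\,\overline{X^r}\big(\mathsf{I}\{X<x\}+\tfrac12\mathsf{I}\{X=x\}\big)=\frac{f^{(r)}(0)}{2i^r}-\frac{(-1)^m}{2\pi i^{r+1}\binom{2m}{m}}\int_{0+}^{\infty-}\big(\Delta_t^{2m+1}f^{(r)}_x\big)(0)\,\frac{dt}t,$$ $$\mathsf{E}\,\overline{X^r}\big(\mathsf{I}\{X>x\}+\tfrac12\mathsf{I}\{X=x\}\big)=\frac{f^{(r)}(0)}{2i^r}+\frac{(-1)^m}{2\pi i^{r+1}\binom{2m}{m}}\int_{0+}^{\infty-}\big(\Delta_t^{2m+1}f^{(r)}_x\big)(0)\,\frac{dt}t,$$ where $f^{(r)}_x(t):=e^{-itx}f^{(r)}(t)$ for all real $x$ and $t$.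
   Context: $\mathsf{I}\{\cdot\}$ is the indicator. $\int_{0+}^{\infty-}:=\lim_{\varepsilon\downarrow0,\,T\uparrow\infty}\int_\varepsilon^T$. $\Delta_v$ is the symmetric difference operator $(\Delta_v\psi)(z):=\psi(z+v)-\psi(z-v)$, and $\Delta_v^n$ is its $n$th power, so that $(\Delta_v^n\psi)(z)=\sum_{j=0}^n(-1)^j\binom nj\psi(z+(n-2j)v)$. Conventions: $0^0=0$; $0^s=\infty$ if $s<0$; $0\cdot\infty=\infty\cdot0=0$. For nonzero complex $z$, $\arg z\in(-\pi,\pi]$ and $z^s:=|z|^s e^{is\arg z}$; the bar denotes complex conjugation. Fractional derivatives: for $\psi\colon\mathbb{R}\to\mathbb{C}$ and real $s$, $\psi^{(s)}(t)$ is defined as follows (whenever the operations make sense). If $s\in\{0,1,2,\dots\}$, it is the usual derivative, $\psi^{(0)}=\psi$. If $s>0$ is not an integer, $k=\lfloor s\rfloor$, $\lambda=s-k$, then $\psi^{(s)}(t):=\frac1{\Gamma(-\lambda)}\int_0^\infty\frac{\psi^{(k)}(t-v)-\psi^{(k)}(t)}{v^{1+\lambda}}\,dv$. If $s\in(-1,0)$, then $\psi^{(s)}(t):=\frac1{\Gamma(-s)}\lim_{T\to\infty}\int_0^{T}\frac{\psi(t-v)}{v^{1+s}}\,dv$. If $s$ is a negative integer, $\psi^{(s)}(t):=\lim_{q\downarrow s}\psi^{(q)}(t)$. If $s<-1$ is not an integer, $\psi^{(s)}(t):=(\psi^{(\lceil s\rceil)})^{(s-\lceil s\rceil)}(t)$.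 If $f$ is the characteristic function of a random variable $X$ with $\mathsf{E}|X|^s<\infty$, then $f^{(s)}(t)$ exists for all real $t$.
   Formalization: The power X^r is read with 0^0 = 1 instead of the paper's convention 0^0 = 0, under which the formulas fail for r = 0 when P(X = 0) > 0 (e.g. X = 0 a.s., m = 0, x = 1: left side of the first formula 0, right side 1). *)

theory Defs
  imports "HOL-Probability.Probability"
begin

section \<open>Powers\<close>

text \<open>
  For \<open>z \<noteq> 0\<close> the library's complex \<open>powr\<close> is \<open>exp (s * Ln z)\<close> with \<open>Im (Ln z)\<close> in
  \<open>(-pi, pi]\<close>, i.e. the principal branch, and \<open>0 powr s = 0\<close> for every \<open>s\<close>, including \<open>s = 0\<close>.
  The power used here has \<open>0\<^sup>0 = 1\<close>.  This is what the identity \<open>\<psi>\<^bsup>(0)\<^esup> = \<psi>\<close> for the derivative of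
  order \<open>0\<close> requires: with \<open>0\<^sup>0 = 0\<close> the inversion formulas fail for \<open>r = 0\<close> as soon as
  \<open>X = 0\<close> has positive probability (e.g. \<open>X = 0\<close> almost surely and \<open>x = 1\<close>).
  For \<open>s < 0\<close> the complex value at \<open>0\<close> is a dummy; the convention \<open>0\<^sup>s = \<infinity>\<close> is carried by
  \<open>abs_pow\<close>, and finiteness of the moment of order \<open>s < 0\<close> makes \<open>X = 0\<close> a null event.
\<close>

definition cpow :: "complex \<Rightarrow> real \<Rightarrow> complex" where
  "cpow z s = (if z = 0 \<and> s = 0 then 1 else z powr of_real s)"

definition abs_pow :: "real \<Rightarrow> real \<Rightarrow> ennreal" where
  "abs_pow a s =
     (if a = 0 then (if s < 0 then \<infinity> else if s = 0 then 1 else 0) else ennreal (\<bar>a\<bar> powr s))"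

section \<open>Fractional derivatives\<close>

definition nat_deriv :: "nat \<Rightarrow> (real \<Rightarrow> complex) \<Rightarrow> real \<Rightarrow> complex" where
  "nat_deriv k \<psi> = ((\<lambda>g t. vector_derivative g (at t)) ^^ k) \<psi>"

text \<open>Order \<open>k + \<mu>\<close> with \<open>0 < \<mu> < 1\<close>.\<close>

definition pos_frac_deriv :: "nat \<Rightarrow> real \<Rightarrow> (real \<Rightarrow> complex) \<Rightarrow> real \<Rightarrow> complex" where
  "pos_frac_deriv k \<mu> \<psi> t =
     of_real (1 / Gamma (- \<mu>)) *
     (LINT v:{0<..}|lborel. (nat_deriv k \<psi> (t - v) - nat_deriv k \<psi> t) / of_real (v powr (1 + \<mu>)))"

text \<open>Order \<open>s\<close> with \<open>-1 < s < 0\<close>.\<close>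

definition neg_frac_deriv :: "real \<Rightarrow> (real \<Rightarrow> complex) \<Rightarrow> real \<Rightarrow> complex" where
  "neg_frac_deriv s \<psi> t =
     of_real (1 / Gamma (- s)) *
     Lim at_top (\<lambda>T. LINT v:{0<..T}|lborel. \<psi> (t - v) / of_real (v powr (1 + s)))"

text \<open>
  Order \<open>-n\<close>.  For \<open>q\<close> just above \<open>-(n + 1)\<close> one has \<open>\<lceil>q\<rceil> = -n\<close>, so the derivative of order \<open>q\<close> is
  the one of order \<open>q - \<lceil>q\<rceil> = q + n\<close> of the derivative of order \<open>-n\<close>; the limit over \<open>q\<close> below is
  therefore the limit defining the derivative of order \<open>-(n + 1)\<close>
  (see \<open>frac_deriv_neg_int\<close>).
\<close>

primrec neg_int_deriv :: "nat \<Rightarrow> (real \<Rightarrow> complex) \<Rightarrow> real \<Rightarrow> complex" where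
  "neg_int_deriv 0 \<psi> = \<psi>"
| "neg_int_deriv (Suc n) \<psi> =
     (\<lambda>t. Lim (at_right (- real (Suc n))) (\<lambda>q. neg_frac_deriv (q + real n) (neg_int_deriv n \<psi>) t))"

definition frac_deriv :: "real \<Rightarrow> (real \<Rightarrow> complex) \<Rightarrow> real \<Rightarrow> complex" where
  "frac_deriv s \<psi> =
     (if 0 \<le> s then
        (if s \<in> \<int> then nat_deriv (nat \<lfloor>s\<rfloor>) \<psi>
         else pos_frac_deriv (nat \<lfloor>s\<rfloor>) (s - of_int \<lfloor>s\<rfloor>) \<psi>)
      else
        (if s \<in> \<int> then neg_int_deriv (nat (- \<lfloor>s\<rfloor>)) \<psi>
         else neg_frac_deriv (s - of_int \<lceil>s\<rceil>) (neg_int_deriv (nat (- \<lceil>s\<rceil>)) \<psi>)))"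

text \<open>The defining equations for negative orders.\<close>

lemma frac_deriv_minus1_0:
  assumes "-1 < s" "s < 0"
  shows "frac_deriv s \<psi> = neg_frac_deriv s \<psi>"
proof -
  have c: "\<lceil>s\<rceil> = 0" using assms by (intro ceiling_unique) auto
  have "s \<notin> \<int>"
  proof
    assume "s \<in> \<int>"
    then obtain k where "s = of_int k" by (auto elim: Ints_cases)
    with c assms show False by simp
  qed
  with c assms show ?thesis by (simp add: frac_deriv_def)
qed

lemma frac_deriv_neg_of_nat: "frac_deriv (- real n) \<psi> = neg_int_deriv n \<psi>"
proof -
  have "- real n \<in> \<int>" "nat (- \<lfloor>- real n\<rfloor>) = n" by (simp_all add: floor_minus)
  then show ?thesis by (cases "n = 0") (simp_all add: frac_deriv_def nat_deriv_def)
qed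

lemma frac_deriv_less_minus1:
  assumes "s < -1" "s \<notin> \<int>"
  shows "frac_deriv s \<psi> = frac_deriv (s - of_int \<lceil>s\<rceil>) (frac_deriv (of_int \<lceil>s\<rceil>) \<psi>)"
proof -
  define n where "n = nat (- \<lceil>s\<rceil>)"
  have n: "of_int \<lceil>s\<rceil> = - real n" using assms by (simp add: n_def)
  have "of_int \<lceil>s\<rceil> \<noteq> s" using assms(2) by (metis Ints_of_int)
  then have "s - of_int \<lceil>s\<rceil> < 0" "-1 < s - of_int \<lceil>s\<rceil>" by linarith+
  then have "frac_deriv (s - of_int \<lceil>s\<rceil>) (frac_deriv (of_int \<lceil>s\<rceil>) \<psi>)
      = neg_frac_deriv (s - of_int \<lceil>s\<rceil>) (neg_int_deriv n \<psi>)"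
    unfolding n by (simp add: frac_deriv_minus1_0 frac_deriv_neg_of_nat)
  with assms show ?thesis by (simp add: frac_deriv_def n_def)
qed

lemma frac_deriv_neg_int:
  assumes "s < 0" "s \<in> \<int>"
  shows "frac_deriv s \<psi> t = Lim (at_right s) (\<lambda>q. frac_deriv q \<psi> t)"
proof -
  obtain k where k: "s = of_int k" using assms(2) by (auto elim: Ints_cases)
  define n where "n = nat (- k - 1)"
  have s: "s = - real (Suc n)" using assms(1) k by (simp add: n_def)
  have "neg_frac_deriv (q + real n) (neg_int_deriv n \<psi>) t = frac_deriv q \<psi> t"
    if "s < q" "q < s + 1" for q
  proof -
    have c: "\<lceil>q\<rceil> = - int n" using that s by (intro ceiling_unique) auto
    have "q \<notin> \<int>"
    proof
      assume "q \<in> \<int>"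
      then obtain j where "q = of_int j" by (auto elim: Ints_cases)
      with c have "q = - real n" by simp
      with that s show False by simp
    qed
    moreover have "q < 0" using that s by simp
    ultimately show ?thesis using c by (simp add: frac_deriv_def)
  qed
  then have "\<forall>\<^sub>F q in at_right s. neg_frac_deriv (q + real n) (neg_int_deriv n \<psi>) t = frac_deriv q \<psi> t"
    using eventually_at_right_real[of s "s + 1"] by (auto elim: eventually_mono)
  then have "Lim (at_right s) (\<lambda>q. neg_frac_deriv (q + real n) (neg_int_deriv n \<psi>) t)
      = Lim (at_right s) (\<lambda>q. frac_deriv q \<psi> t)"
    by (rule Lim_cong) simp
  then show ?thesis unfolding s frac_deriv_neg_of_nat by simp
qed

section \<open>Symmetric differences and the two-sided improper integral\<close>

definition diff_op :: "real \<Rightarrow> (real \<Rightarrow> complex) \<Rightarrow> real \<Rightarrow> complex" where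
  "diff_op v \<psi> z = \<psi> (z + v) - \<psi> (z - v)"

definition has_improper_integral :: "(real \<Rightarrow> complex) \<Rightarrow> complex \<Rightarrow> bool" where
  "has_improper_integral g J \<longleftrightarrow>
     (\<forall>\<epsilon> T. 0 < \<epsilon> \<longrightarrow> \<epsilon> < T \<longrightarrow> set_integrable lborel {\<epsilon>..T} g) \<and>
     ((\<lambda>(\<epsilon>, T). LINT t:{\<epsilon>..T}|lborel. g t) \<longlongrightarrow> J) (at_right 0 \<times>\<^sub>F at_top)"

definition improper_integrable :: "(real \<Rightarrow> complex) \<Rightarrow> bool" where
  "improper_integrable g \<longleftrightarrow> (\<exists>J. has_improper_integral g J)"

definition improper_integral :: "(real \<Rightarrow> complex) \<Rightarrow> complex" where
  "improper_integral g = (THE J. has_improper_integral g J)"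

definition shifted_deriv :: "(real \<Rightarrow> complex) \<Rightarrow> real \<Rightarrow> real \<Rightarrow> real \<Rightarrow> complex" where
  "shifted_deriv f r x t = exp (- (\<i> * of_real (t * x))) * frac_deriv r f t"

end

theory Submission
  imports Defs
begin

text \<open>
  Fubini and the two integrals \<open>\<integral>\<^sub>0\<^sup>\<infinity> (exp (-\<i>vy) - 1) v\<^bsup>-1-\<lambda>\<^esup> dv = \<Gamma>(-\<lambda>) (\<i>y)\<^sup>\<lambda>\<close> and
  \<open>\<integral>\<^sub>0\<^sup>\<infinity> exp (-\<i>vy) v\<^bsup>-1-s\<^esup> dv = \<Gamma>(-s) (\<i>y)\<^sup>s\<close> show that the derivative of order \<open>r\<close> of the
  characteristic function is the Fourier transform of \<open>(\<i>y)\<^sup>r\<close> with respect to the distribution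
  of \<open>X\<close>.  Both integrals reduce to \<open>\<integral>\<^sub>0\<^sup>\<infinity> u\<^bsup>-z\<^esup> / (u + \<i>) du\<close>, that is, to
  \<open>\<integral>\<^sub>0\<^sup>\<infinity> u\<^bsup>b-1\<^esup> / (1 + u) du = \<Gamma>(b) \<Gamma>(1 - b)\<close> and the reflection formula.

  The difference of order \<open>2m + 1\<close> at \<open>0\<close> is a combination with alternating binomial coefficients of the
  differences \<open>G(kt) - G(-kt)\<close>, \<open>k\<close> odd.  By dominated convergence and the limit \<open>\<pi>/2\<close> of the sine integral,
  the improper integral of \<open>(G(kt) - G(-kt)) / t\<close> is \<open>\<i>\<pi> E (\<i>X)\<^sup>r sgn (X - x)\<close> for every \<open>k > 0\<close>, and the
  coefficients add up to \<open>(-1)\<^sup>m\<close> times the central binomial coefficient.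
\<close>

section \<open>Mellin transforms of oscillating functions\<close>

lemma nn_integral_Gamma_scaled:
  fixes a w :: real
  assumes "a > 0" "w > 0"
  shows "(\<integral>\<^sup>+u. ennreal (indicator {0<..} u * (u powr (a - 1) * exp (- (w * u)))) \<partial>lborel)
    = ennreal (Gamma a * w powr (- a))"
proof -
  have "ennreal (Gamma a) = (\<integral>\<^sup>+t. ennreal (indicator {0..} t * t powr (a - 1) / exp t) \<partial>lborel)"
    by (rule Gamma_conv_nn_integral_real) fact
  also have "\<dots> = \<bar>w\<bar> * (\<integral>\<^sup>+t. ennreal (indicator {0..} (0 + w * t) * (0 + w * t) powr (a - 1) / exp (0 + w * t)) \<partial>lborel)"
    by (rule nn_integral_real_affine) (use assms in auto)
  also have "\<dots> = w * (\<integral>\<^sup>+t. ennreal (w powr (a - 1)) * ennreal (indicator {0<..} t * (t powr (a - 1) * exp (- (w * t)))) \<partial>lborel)"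
    using assms
    by (auto intro!: arg_cong2[where f="(*)"] nn_integral_cong
      simp: indicator_def zero_le_mult_iff powr_mult exp_minus field_simps simp flip: ennreal_mult)
  also have "\<dots> = ennreal (w powr a) * (\<integral>\<^sup>+t. ennreal (indicator {0<..} t * (t powr (a - 1) * exp (- (w * t)))) \<partial>lborel)"
    using assms
    by (subst nn_integral_cmult) (auto simp: mult.assoc[symmetric] powr_diff simp flip: ennreal_mult)
  finally have "ennreal (w powr (-a)) * ennreal (Gamma a) = ennreal (w powr (-a)) * ennreal (w powr a) * (\<integral>\<^sup>+t. ennreal (indicator {0<..} t * (t powr (a - 1) * exp (- (w * t)))) \<partial>lborel)"
    by (simp add: mult.assoc)
  with assms show ?thesis
    by (simp add: powr_minus_divide Gamma_real_nonneg mult.commute flip: ennreal_mult)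
qed

lemma has_bochner_integral_Gamma_scaled:
  fixes a w :: real
  assumes "a > 0" "w > 0"
  shows "has_bochner_integral lborel (\<lambda>u. indicator {0<..} u * (u powr (a - 1) * exp (- (w * u))))
    (Gamma a * w powr (- a))"
  using assms
  by (intro has_bochner_integral_nn_integral nn_integral_Gamma_scaled) (auto simp: Gamma_real_nonneg)

lemma Gamma_reflection_real: "Gamma z * Gamma (1 - z) = pi / sin (pi * z)" for z :: real
  using Gamma_reflection_complex[of "of_real z"]
  by (metis Gamma_complex_of_real of_real_1 of_real_diff of_real_divide of_real_eq_iff of_real_mult sin_of_real)

text \<open>Write \<open>1 / (1 + u)\<close> as the integral of \<open>exp (- ((1 + u) * w))\<close>
  over \<open>w > 0\<close>. Exchanging the two nonnegative integrals leaves
  \<open>Gamma b * Gamma (1 - b)\<close>, which reflection evaluates.\<close>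

lemma nn_integral_powr_over_1_plus:
  fixes b :: real
  assumes "0 < b" "b < 1"
  shows "(\<integral>\<^sup>+u. ennreal (indicator {0<..} u * (u powr (b - 1) / (1 + u))) \<partial>lborel) = ennreal (pi / sin (pi * b))"
proof -
  let ?I = "indicator {0<..} :: real \<Rightarrow> real"
  \<comment> \<open>The trivial power \<open>w powr (1 - 1)\<close> gives the inner integrand the
    shape of the scaled Gamma integral with \<open>a = 1\<close>.\<close>
  have "(\<integral>\<^sup>+u. ennreal (?I u * (u powr (b - 1) / (1 + u))) \<partial>lborel)
    = (\<integral>\<^sup>+u. ennreal (?I u * u powr (b - 1)) * (\<integral>\<^sup>+w. ennreal (?I w * (w powr (1 - 1) * exp (- ((1 + u) * w)))) \<partial>lborel) \<partial>lborel)"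
  proof (intro nn_integral_cong)
    fix u :: real
    show "ennreal (?I u * (u powr (b - 1) / (1 + u)))
      = ennreal (?I u * u powr (b - 1)) * (\<integral>\<^sup>+w. ennreal (?I w * (w powr (1 - 1) * exp (- ((1 + u) * w)))) \<partial>lborel)"
    proof (cases "u > 0")
      case True
      then show ?thesis
        by (subst nn_integral_Gamma_scaled) (auto simp: powr_minus_divide simp flip: ennreal_mult)
    qed auto
  qed
  also have "\<dots> = (\<integral>\<^sup>+u. \<integral>\<^sup>+w. ennreal (?I u * u powr (b - 1)) * ennreal (?I w * (w powr (1 - 1) * exp (- ((1 + u) * w)))) \<partial>lborel \<partial>lborel)"
    by (intro nn_integral_cong nn_integral_cmult[symmetric]) auto
  also have "\<dots> = (\<integral>\<^sup>+w. \<integral>\<^sup>+u. ennreal (?I u * u powr (b - 1)) * ennreal (?I w * (w powr (1 - 1) * exp (- ((1 + u) * w)))) \<partial>lborel \<partial>lborel)"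
    by (intro lborel_pair.Fubini') measurable
  also have "\<dots> = (\<integral>\<^sup>+w. \<integral>\<^sup>+u. ennreal (?I w * exp (- w)) * ennreal (?I u * (u powr (b - 1) * exp (- (w * u)))) \<partial>lborel \<partial>lborel)"
    by (intro nn_integral_cong) (auto simp: indicator_def algebra_simps exp_add exp_diff exp_minus field_simps simp flip: ennreal_mult)
  also have "\<dots> = (\<integral>\<^sup>+w. ennreal (?I w * exp (- w)) * (\<integral>\<^sup>+u. ennreal (?I u * (u powr (b - 1) * exp (- (w * u)))) \<partial>lborel) \<partial>lborel)"
    by (intro nn_integral_cong nn_integral_cmult) auto
  also have "\<dots> = (\<integral>\<^sup>+w. ennreal (Gamma b) * ennreal (?I w * (w powr ((1 - b) - 1) * exp (- (1 * w)))) \<partial>lborel)"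
  proof (intro nn_integral_cong)
    fix w :: real
    show "ennreal (?I w * exp (- w)) * (\<integral>\<^sup>+u. ennreal (?I u * (u powr (b - 1) * exp (- (w * u)))) \<partial>lborel)
      = ennreal (Gamma b) * ennreal (?I w * (w powr ((1 - b) - 1) * exp (- (1 * w))))"
    proof (cases "w > 0")
      case True
      with assms show ?thesis
        by (subst nn_integral_Gamma_scaled) (auto simp: Gamma_real_nonneg mult_ac simp flip: ennreal_mult)
    qed auto
  qed
  also have "\<dots> = ennreal (Gamma b) * ennreal (Gamma (1 - b) * 1 powr (-(1 - b)))"
    using assms by (subst nn_integral_cmult, measurable, subst nn_integral_Gamma_scaled) auto
  also have "\<dots> = ennreal (pi / sin (pi * b))"
    using assms Gamma_reflection_real[of b] by (simp add: Gamma_real_nonneg flip: ennreal_mult)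
  finally show ?thesis .
qed

text \<open>The substitution \<open>w = u\<^sup>2\<close> reduces this to the previous integral with
  \<open>b = a / 2\<close>.\<close>

lemma has_bochner_integral_powr_over_1_plus_square:
  fixes a :: real
  assumes "0 < a" "a < 2"
  shows "has_bochner_integral lborel (\<lambda>u. indicator {0<..} u * (u powr (a - 1) / (1 + u\<^sup>2)))
    (pi / 2 / sin (pi * a / 2))"
proof -
  define f where "f w = w powr (a / 2 - 1) / (1 + w)" for w :: real
  define I where "I = pi / sin (pi * (a / 2))"
  have "I \<ge> 0" using assms unfolding I_def by (intro divide_nonneg_nonneg sin_ge_zero) auto
  have "has_bochner_integral lborel (\<lambda>w. indicator {0<..} w * f w) I"
    unfolding f_def I_def using assms \<open>I \<ge> 0\<close>
    by (intro has_bochner_integral_nn_integral nn_integral_powr_over_1_plus) (auto simp: indicator_def I_def)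
  then have f: "set_integrable lborel {0<..} f" "(LINT w:{0<..}|lborel. f w) = I"
    by (auto simp: has_bochner_integral_iff set_integrable_def set_lebesgue_integral_def)
  have img: "(\<lambda>u::real. u\<^sup>2) ` {0<..} = {0<..}"
  proof (intro equalityI subsetI)
    fix w :: real assume "w \<in> {0<..}"
    then show "w \<in> (\<lambda>u::real. u\<^sup>2) ` {0<..}" by (intro image_eqI[of _ _ "sqrt w"]) auto
  qed auto
  \<comment> \<open>The change of variables speaks of absolute integrability for Lebesgue measure;
    \<open>integrable_completion\<close> transfers it to and from \<open>lborel\<close> for Borel
    functions.\<close>
  have *: "(\<lambda>u. \<bar>2 * u\<bar> * f (u\<^sup>2)) absolutely_integrable_on {0<..} \<and>
       integral {0<..} (\<lambda>u. \<bar>2 * u\<bar> * f (u\<^sup>2)) = I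
     \<longleftrightarrow> f absolutely_integrable_on ((\<lambda>u::real. u\<^sup>2) ` {0<..}) \<and> integral ((\<lambda>u::real. u\<^sup>2) ` {0<..}) f = I"
    by (rule has_absolute_integral_change_of_variables_1')
      (auto intro!: derivative_eq_intros inj_onI)
  have "f absolutely_integrable_on {0<..}" using f(1)
    unfolding set_integrable_def by (subst integrable_completion) (auto simp: f_def)
  moreover have "integral {0<..} f = I"
    using f by (metis set_borel_integral_eq_integral(2))
  ultimately have **: "(\<lambda>u. \<bar>2 * u\<bar> * f (u\<^sup>2)) absolutely_integrable_on {0<..}"
       "integral {0<..} (\<lambda>u. \<bar>2 * u\<bar> * f (u\<^sup>2)) = I"
    using * unfolding img by auto
  then have 1: "set_integrable lborel {0<..} (\<lambda>u. \<bar>2 * u\<bar> * f (u\<^sup>2))"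
    unfolding set_integrable_def by (subst (asm) integrable_completion) (auto simp: f_def)
  with ** have "(LINT u:{0<..}|lborel. \<bar>2 * u\<bar> * f (u\<^sup>2)) = I"
    by (metis set_borel_integral_eq_integral(2))
  with 1 have "has_bochner_integral lborel (\<lambda>u. indicator {0<..} u * (\<bar>2 * u\<bar> * f (u\<^sup>2))) I"
    by (auto simp: has_bochner_integral_iff set_integrable_def set_lebesgue_integral_def)
  then have "has_bochner_integral lborel (\<lambda>u. (indicator {0<..} u * (\<bar>2 * u\<bar> * f (u\<^sup>2))) / 2) (I / 2)"
    by (rule has_bochner_integral_divide_zero)
  also have "(\<lambda>u. (indicator {0<..} u * (\<bar>2 * u\<bar> * f (u\<^sup>2))) / 2) = (\<lambda>u. indicator {0<..} u * (u powr (a - 1) / (1 + u\<^sup>2)))"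
  proof
    fix u :: real
    show "(indicator {0<..} u * (\<bar>2 * u\<bar> * f (u\<^sup>2))) / 2 = indicator {0<..} u * (u powr (a - 1) / (1 + u\<^sup>2))"
    proof (cases "u > 0")
      case True
      then have "u\<^sup>2 = u powr 2" by simp
      then have "(u\<^sup>2) powr (a / 2 - 1) = u powr (a - 2)"
        by (simp only: powr_powr) (simp add: algebra_simps)
      moreover have "u powr (a - 1) = u powr (a - 2) * u powr 1"
        unfolding powr_add[symmetric] by simp
      moreover have "1 + u\<^sup>2 > 0" by (simp add: add_pos_nonneg)
      ultimately show ?thesis using True by (simp add: f_def divide_simps)
    qed auto
  qed
  finally show ?thesis by (simp add: I_def mult.commute)
qed

text \<open>Since \<open>1 / (u + \<i>) = (u - \<i>) / (1 + u\<^sup>2)\<close>, the real and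
  imaginary parts are the preceding integral at \<open>a = 2 - z\<close> and
  \<open>a = 1 - z\<close>.\<close>

lemma has_bochner_integral_powr_over_plus_i:
  fixes z :: real
  assumes "0 < z" "z < 1"
  shows "has_bochner_integral lborel
    (\<lambda>u. indicator {0<..} u *\<^sub>R (of_real (u powr (- z)) / (of_real u + \<i>)))
    (of_real (Gamma z * Gamma (1 - z)) * cis (- (pi * z / 2)))"
proof -
  let ?I = "indicator {0<..} :: real \<Rightarrow> real"
  have "has_bochner_integral lborel
     (\<lambda>u. complex_of_real (?I u * (u powr ((2 - z) - 1) / (1 + u\<^sup>2))) - \<i> * of_real (?I u * (u powr ((1 - z) - 1) / (1 + u\<^sup>2))))
     (of_real (pi / 2 / sin (pi * (2 - z) / 2)) - \<i> * of_real (pi / 2 / sin (pi * (1 - z) / 2)))"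
    using assms by (intro has_bochner_integral_diff has_bochner_integral_mult_right has_bochner_integral_of_real
       has_bochner_integral_powr_over_1_plus_square) auto
  also have "(\<lambda>u. complex_of_real (?I u * (u powr ((2 - z) - 1) / (1 + u\<^sup>2))) - \<i> * of_real (?I u * (u powr ((1 - z) - 1) / (1 + u\<^sup>2))))
    = (\<lambda>u. ?I u *\<^sub>R (of_real (u powr (- z)) / (of_real u + \<i>)))"
  proof
    fix u :: real
    show "complex_of_real (?I u * (u powr ((2 - z) - 1) / (1 + u\<^sup>2))) - \<i> * of_real (?I u * (u powr ((1 - z) - 1) / (1 + u\<^sup>2)))
      = ?I u *\<^sub>R (of_real (u powr (- z)) / (of_real u + \<i>))"
    proof (cases "u > 0")
      case True
      have "u powr (1 - z) = u powr 1 * u powr (- z)"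
        unfolding powr_add[symmetric] by simp
      moreover have "1 / (of_real u + \<i>) = (of_real u - \<i>) / complex_of_real (1 + u\<^sup>2)"
      proof -
        have "(of_real u - \<i>) * (of_real u + \<i>) = complex_of_real (1 + u\<^sup>2)"
          by (simp add: algebra_simps power2_eq_square)
        moreover have "of_real u + \<i> \<noteq> 0" "of_real u - \<i> \<noteq> 0" by (auto simp: complex_eq_iff)
        ultimately show ?thesis
          by (metis nonzero_divide_mult_cancel_left)
      qed
      then have "of_real (u powr (- z)) / (of_real u + \<i>)
        = of_real (u powr (- z)) * ((of_real u - \<i>) / complex_of_real (1 + u\<^sup>2))"
        by (metis times_divide_eq_right mult.right_neutral)
      ultimately show ?thesis using True
        by (simp add: diff_divide_distrib algebra_simps)
    qed auto
  qed
  also have "complex_of_real (pi / 2 / sin (pi * (2 - z) / 2)) - \<i> * of_real (pi / 2 / sin (pi * (1 - z) / 2))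
     = of_real (Gamma z * Gamma (1 - z)) * cis (- (pi * z / 2))"
  proof -
    \<comment> \<open>With \<open>y = pi * z / 2\<close> the parts are
      \<open>pi / (2 * sin y)\<close> and \<open>- pi / (2 * cos y)\<close>, together
      \<open>pi / sin (2 * y)\<close> times \<open>cis (- y)\<close>.\<close>
    define y where "y = pi * z / 2"
    have y: "0 < y" "y < pi / 2" using assms unfolding y_def by auto
    then have sc: "sin y > 0" "cos y > 0" by (auto intro!: sin_gt_zero cos_gt_zero)
    have "sin (pi * (2 - z) / 2) = sin (pi - y)" "sin (pi * (1 - z) / 2) = sin (pi / 2 - y)"
      unfolding y_def by (simp_all add: algebra_simps diff_divide_distrib)
    then have 1: "sin (pi * (2 - z) / 2) = sin y" "sin (pi * (1 - z) / 2) = cos y"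
      by (simp_all add: cos_sin_eq)
    have 2: "pi * z = 2 * y" unfolding y_def by simp
    show ?thesis unfolding Gamma_reflection_real 1 2 sin_double using sc
      by (auto simp: complex_eq_iff field_simps)
  qed
  finally show ?thesis .
qed

section \<open>Truncated oscillating integrals\<close>

lemma set_integral_cexp_neg:
  fixes c :: complex and T :: real
  assumes "c \<noteq> 0" "T > 0"
  shows "set_integrable lborel {0<..T} (\<lambda>v. exp (- (c * of_real v)))"
    and "(LINT v:{0<..T}|lborel. exp (- (c * of_real v))) = (1 - exp (- (c * of_real T))) / c"
proof -
  have "set_integrable lborel {0..T} (\<lambda>v. exp (- (c * of_real v)))"
    by (intro borel_integrable_atLeastAtMost' continuous_intros)
  then show 1: "set_integrable lborel {0<..T} (\<lambda>v. exp (- (c * of_real v)))"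
    by (rule set_integrable_subset) auto
  have "((\<lambda>v. exp (- (c * of_real v))) has_integral (- exp (- (c * of_real T)) / c - (- exp (- (c * of_real 0)) / c))) {0..T}"
    using assms
    by (intro fundamental_theorem_of_calculus) 
      (auto intro!: derivative_eq_intros has_vector_derivative_real_field simp: field_simps)
  then have "((\<lambda>v. exp (- (c * of_real v))) has_integral (1 - exp (- (c * of_real T))) / c) {0..T}"
    by (simp add: diff_divide_distrib)
  then have "((\<lambda>v. exp (- (c * of_real v))) has_integral (1 - exp (- (c * of_real T))) / c) {0<..T}"
    by (subst (asm) has_integral_spike_set_eq[where T = "{0<..T}"]) (auto intro: negligible_subset[of "{0}"])
  with 1 show "(LINT v:{0<..T}|lborel. exp (- (c * of_real v))) = (1 - exp (- (c * of_real T))) / c"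
    by (metis integral_unique set_borel_integral_eq_integral(2))
qed

lemma set_integrable_powr_Ioc:
  fixes a T :: real
  assumes "a > -1" "T \<ge> 0"
  shows "set_integrable lborel {0<..T} (\<lambda>v. v powr a)"
proof -
  have "(\<lambda>v. v powr a) integrable_on {0..T}"
    using has_integral_powr_from_0[OF assms] by blast
  then have "(\<lambda>v. v powr a) absolutely_integrable_on {0..T}"
    by (rule nonnegative_absolutely_integrable_1) auto
  then have "set_integrable lborel {0..T} (\<lambda>v. v powr a)"
    unfolding set_integrable_def by (subst (asm) integrable_completion) auto
  then show ?thesis by (rule set_integrable_subset) auto
qed

text \<open>Truncated Mellin integral of \<open>exp (- \<i> * v)\<close>. For
  \<open>0 < z < 1\<close> the full integral converges only conditionally at infinity, so the
  cut-off \<open>T\<close> stays a parameter, as in \<open>neg_frac_deriv\<close> with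
  \<open>z = - s\<close>.\<close>

definition osc :: "real \<Rightarrow> real \<Rightarrow> complex" where
  "osc z T = (LINT v:{0<..T}|lborel. iexp (- v) / of_real (v powr (1 - z)))"

text \<open>Writing \<open>v\<^bsup>z - 1\<^esup>\<close> as a Laplace transform turns the conditionally convergent oscillating integral
  into an absolutely convergent one, dominated uniformly in \<open>T\<close>.\<close>

lemma osc_eq:
  assumes z: "0 < z" "z < 1" and T: "T > 0"
  shows "osc z T = of_real (1 / Gamma (1 - z)) *
    (LINT u:{0<..}|lborel. of_real (u powr (- z)) * ((1 - exp (- ((of_real u + \<i>) * of_real T))) / (of_real u + \<i>)))"
proof -
  let ?I = "indicator {0<..} :: real \<Rightarrow> real" and ?J = "indicator {0<..T} :: real \<Rightarrow> real"
  define F where "F = (\<lambda>v u. (?J v * (?I u * (u powr ((1 - z) - 1) * exp (- (v * u))))) *\<^sub>R iexp (- v))"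
  have G: "Gamma (1 - z) > 0" using z by simp
  have inner: "has_bochner_integral lborel (\<lambda>u. ?J v * (?I u * (u powr ((1 - z) - 1) * exp (- (v * u)))))
      (?J v * (Gamma (1 - z) * v powr (- (1 - z))))" for v
    using z has_bochner_integral_Gamma_scaled[of "1 - z" v]
    by (cases "v > 0") (auto intro!: has_bochner_integral_mult_right)
  \<comment> \<open>The cut-off is what permits Fubini: integrating the modulus over
    \<open>u\<close> leaves a multiple of \<open>v powr (z - 1)\<close> on \<open>{0<..T}\<close>,
    integrable because \<open>z > 0\<close>.\<close>
  have "integrable (lborel \<Otimes>\<^sub>M lborel) (case_prod F)"
  proof (rule lborel_pair.Fubini_integrable)
    show "case_prod F \<in> borel_measurable (lborel \<Otimes>\<^sub>M lborel)"
      unfolding F_def by measurable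
    have "(LINT u|lborel. norm (F v u)) = ?J v * (Gamma (1 - z) * v powr (- (1 - z)))" for v
    proof -
      have "(LINT u|lborel. norm (F v u)) = (LINT u|lborel. ?J v * (?I u * (u powr ((1 - z) - 1) * exp (- (v * u)))))"
        unfolding F_def by (intro Bochner_Integration.integral_cong) (auto simp: indicator_def)
      then show ?thesis using inner[of v] by (simp only: has_bochner_integral_iff)
    qed
    moreover have "integrable lborel (\<lambda>v. ?J v * (Gamma (1 - z) * v powr (- (1 - z))))"
      using set_integrable_mult_right[OF set_integrable_powr_Ioc[of "-(1 - z)" T], of "Gamma (1 - z)"] z T
      by (simp add: set_integrable_def)
    ultimately show "integrable lborel (\<lambda>v. LINT u|lborel. norm (case_prod F (v, u)))"
      by simp
    show "AE v in lborel. integrable lborel (\<lambda>u. case_prod F (v, u))"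
      using inner unfolding F_def has_bochner_integral_iff by (intro AE_I2) auto
  qed
  then have "(LINT u|lborel. LINT v|lborel. F v u) = (LINT v|lborel. LINT u|lborel. F v u)"
    by (rule lborel_pair.Fubini_integral)
  also have "(\<lambda>v. LINT u|lborel. F v u) = (\<lambda>v. of_real (Gamma (1 - z)) * (?J v *\<^sub>R (iexp (- v) / of_real (v powr (1 - z)))))"
  proof
    fix v
    have "(LINT u|lborel. F v u) = (?J v * (Gamma (1 - z) * v powr (- (1 - z)))) *\<^sub>R iexp (- v)"
      using inner[of v] unfolding F_def has_bochner_integral_iff by simp
    then show "(LINT u|lborel. F v u) = of_real (Gamma (1 - z)) * (?J v *\<^sub>R (iexp (- v) / of_real (v powr (1 - z))))"
      by (simp add: indicator_def powr_minus_divide scaleR_conv_of_real powr_diff)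
  qed
  also have "(LINT v|lborel. of_real (Gamma (1 - z)) * (?J v *\<^sub>R (iexp (- v) / of_real (v powr (1 - z)))))
     = of_real (Gamma (1 - z)) * osc z T"
    unfolding osc_def set_lebesgue_integral_def by (rule integral_mult_right_zero)
  \<comment> \<open>This link rewrites the left side of the Fubini identity, so the chain ends with
    the \<open>u\<close>-integral on the left and \<open>osc\<close> on the right.\<close>
  also have "(\<lambda>u. LINT v|lborel. F v u) = (\<lambda>u. ?I u *\<^sub>R (of_real (u powr (- z)) * ((1 - exp (- ((of_real u + \<i>) * of_real T))) / (of_real u + \<i>))))"
  proof
    fix u :: real
    have "(LINT v|lborel. F v u) = (LINT v|lborel. (?I u * u powr (- z)) *\<^sub>R (?J v *\<^sub>R exp (- ((of_real u + \<i>) * of_real v))))"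
      unfolding F_def
      by (intro Bochner_Integration.integral_cong) 
        (auto simp: indicator_def scaleR_conv_of_real exp_of_real[symmetric] exp_add[symmetric] algebra_simps)
    also have "\<dots> = (?I u * u powr (- z)) *\<^sub>R (LINT v:{0<..T}|lborel. exp (- ((of_real u + \<i>) * of_real v)))"
      unfolding set_lebesgue_integral_def by (rule integral_scaleR_right)
    also have "(LINT v:{0<..T}|lborel. exp (- ((of_real u + \<i>) * of_real v))) 
      = (1 - exp (- ((of_real u + \<i>) * of_real T))) / (of_real u + \<i>)"
      by (rule set_integral_cexp_neg) (use T in \<open>auto simp: complex_eq_iff\<close>)
    finally show "(LINT v|lborel. F v u) = ?I u *\<^sub>R (of_real (u powr (- z)) * ((1 - exp (- ((of_real u + \<i>) * of_real T))) / (of_real u + \<i>)))"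
      by (simp add: scaleR_conv_of_real mult.assoc)
  qed
  finally show ?thesis using G
    unfolding set_lebesgue_integral_def[symmetric] by (simp add: field_simps)
qed

text \<open>For \<open>u > 0\<close> the term \<open>exp (- ((u + \<i>) * T))\<close> vanishes as
  \<open>T\<close> grows and has modulus at most \<open>1\<close> for \<open>T > 0\<close>. Hence
  twice the norm of the limiting integrand is a majorant free of \<open>T\<close>, which yields both
  the limit and the uniform bound.\<close>

lemma
  assumes z: "0 < z" "z < 1"
  shows osc_tendsto: "(osc z \<longlongrightarrow> of_real (Gamma z) * cis (- (pi * z / 2))) at_top"
    and osc_bounded: "\<exists>B. \<forall>T. norm (osc z T) \<le> B"
proof -
  let ?I = "indicator {0<..} :: real \<Rightarrow> real"
  define s where "s = (\<lambda>T u. ?I u *\<^sub>R (complex_of_real (u powr (- z)) * ((1 - exp (- ((of_real u + \<i>) * of_real T))) / (of_real u + \<i>))))"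
  define g where "g = (\<lambda>u. ?I u *\<^sub>R (complex_of_real (u powr (- z)) / (of_real u + \<i>)))"
  have G: "Gamma (1 - z) > 0" using z by simp
  have g: "integrable lborel g" "integral\<^sup>L lborel g = of_real (Gamma z * Gamma (1 - z)) * cis (- (pi * z / 2))"
    using has_bochner_integral_powr_over_plus_i[OF z] unfolding g_def has_bochner_integral_iff by auto
  have bd: "norm (s T u) \<le> 2 * norm (g u)" if "T > 0" for T u
  proof (cases "u > 0")
    case True
    have "norm (1 - exp (- ((of_real u + \<i>) * of_real T))) \<le> 1 + norm (exp (- ((of_real u + \<i>) * of_real T)))"
      using norm_triangle_ineq4[of 1] by (metis norm_one)
    also have "\<dots> \<le> 2" using True that by simp
    finally show ?thesis using True
      unfolding s_def g_def by (simp add: norm_mult norm_divide divide_simps mult_right_mono)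
  qed (auto simp: s_def g_def)
  have [measurable]: "s T \<in> borel_measurable lborel" "g \<in> borel_measurable lborel" for T
    unfolding s_def g_def by measurable
  have eq: "osc z T = of_real (1 / Gamma (1 - z)) * (LINT u|lborel. s T u)" if "T > 0" for T
    using osc_eq[OF z that] unfolding s_def set_lebesgue_integral_def .
  have "((\<lambda>T. LINT u|lborel. s T u) \<longlongrightarrow> integral\<^sup>L lborel g) at_top"
  proof (rule integral_dominated_convergence_at_top[where w = "\<lambda>u. 2 * norm (g u)"])
    show "\<forall>\<^sub>F T in at_top. AE u in lborel. norm (s T u) \<le> 2 * norm (g u)"
      using eventually_gt_at_top[of 0] by eventually_elim (use bd in auto)
    show "AE u in lborel. ((\<lambda>T. s T u) \<longlongrightarrow> g u) at_top"
    proof (intro AE_I2)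
      fix u :: real
      show "((\<lambda>T. s T u) \<longlongrightarrow> g u) at_top"
      proof (cases "u > 0")
        case True
        have "((\<lambda>T. exp (- (u * T))) \<longlongrightarrow> 0) at_top"
          using True by real_asymp
        then have "((\<lambda>T. exp (- ((of_real u + \<i>) * of_real T))) \<longlongrightarrow> 0) at_top"
          by (subst tendsto_norm_zero_iff[symmetric]) simp
        then have "((\<lambda>T. s T u) \<longlongrightarrow> ?I u *\<^sub>R (complex_of_real (u powr (- z)) * ((1 - 0) / (of_real u + \<i>)))) at_top"
          unfolding s_def by (intro tendsto_intros) (auto simp: complex_eq_iff)
        then show ?thesis by (simp add: g_def)
      qed (auto simp: s_def g_def)
    qed
  qed (use g in auto)
  then have "((\<lambda>T. of_real (1 / Gamma (1 - z)) * (LINT u|lborel. s T u)) \<longlongrightarrow> of_real (1 / Gamma (1 - z)) * integral\<^sup>L lborel g) at_top"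
    by (intro tendsto_intros)
  also have "?this \<longleftrightarrow> (osc z \<longlongrightarrow> of_real (1 / Gamma (1 - z)) * integral\<^sup>L lborel g) at_top"
    by (intro filterlim_cong[OF refl refl] eventually_mono[OF eventually_gt_at_top[of 0]]) (simp add: eq)
  finally show "(osc z \<longlongrightarrow> of_real (Gamma z) * cis (- (pi * z / 2))) at_top"
    using G by (simp add: g(2))
  have "norm (osc z T) \<le> 1 / Gamma (1 - z) * (LINT u|lborel. 2 * norm (g u))" for T
  proof (cases "T > 0")
    case True
    have "norm (LINT u|lborel. s T u) \<le> (LINT u|lborel. 2 * norm (g u))"
    proof (rule Bochner_Integration.integral_norm_bound_integral)
      show "integrable lborel (s T)"
        by (rule Bochner_Integration.integrable_bound[of _ "\<lambda>u. 2 * norm (g u)"]) (use g bd True in auto)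
    qed (use g bd True in auto)
    then show ?thesis using G by (simp add: eq True norm_divide field_simps)
  next
    case False
    then have "osc z T = 0" unfolding osc_def by (simp add: set_lebesgue_integral_def)
    then show ?thesis using G by (auto intro!: divide_nonneg_nonneg)
  qed
  then show "\<exists>B. \<forall>T. norm (osc z T) \<le> B" by blast
qed

section \<open>The compensated kernel integral for orders between \<open>0\<close> and
  \<open>1\<close>\<close>

lemma has_bochner_integral_cexp_neg:
  assumes "Re c > 0"
  shows "has_bochner_integral lborel (\<lambda>v. indicator {0<..} v *\<^sub>R exp (- (c * of_real v))) (1 / c)"
proof -
  have "has_bochner_integral lborel (\<lambda>v. indicator {0<..} v * (v powr (1 - 1) * exp (- (Re c * v)))) (Gamma 1 * Re c powr (-1))"
    using assms by (intro has_bochner_integral_Gamma_scaled) auto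
  then have 0: "integrable lborel (\<lambda>v. indicator {0<..} v * exp (- (Re c * v)))"
    unfolding has_bochner_integral_iff
    by (elim conjE Bochner_Integration.integrable_cong[THEN iffD1, OF refl, rotated]) (auto simp: indicator_def)
  have 1: "set_integrable lborel {0<..} (\<lambda>v. exp (- (c * of_real v)))"
    unfolding set_integrable_def
    by (rule Bochner_Integration.integrable_bound[OF 0]) (auto simp: indicator_def)
  have c: "c \<noteq> 0" using assms by auto
  have "(LBINT v=0..\<infinity>. exp (- (c * of_real v))) = 0 - (- 1 / c)"
  proof (rule interval_integral_FTC_integrable)
    show "((\<lambda>v. - exp (- (c * of_real v)) / c) has_vector_derivative exp (- (c * of_real v))) (at v)" for v
      using c by (auto intro!: derivative_eq_intros has_vector_derivative_real_field simp: field_simps)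
    show "(((\<lambda>v. - exp (- (c * of_real v)) / c) \<circ> real_of_ereal) \<longlongrightarrow> - 1 / c) (at_right 0)"
      unfolding zero_ereal_def
      by (rule ereal_tendsto_simps1(2)[THEN iffD2]) (auto intro!: tendsto_eq_intros simp: c)
    show "(((\<lambda>v. - exp (- (c * of_real v)) / c) \<circ> real_of_ereal) \<longlongrightarrow> 0) (at_left \<infinity>)"
    proof (rule ereal_tendsto_simps1(3)[THEN iffD2])
      have "((\<lambda>v. exp (- (Re c * v))) \<longlongrightarrow> 0) at_top"
        using assms by real_asymp
      then have "((\<lambda>v. exp (- (c * of_real v))) \<longlongrightarrow> 0) at_top"
        by (subst tendsto_norm_zero_iff[symmetric]) simp
      from tendsto_divide[OF tendsto_minus[OF this] tendsto_const c]
      show "((\<lambda>v. - exp (- (c * of_real v)) / c) \<longlongrightarrow> 0) at_top"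
        by simp
    qed
  qed (use 1 in \<open>auto intro!: continuous_intros simp: zero_ereal_def einterval_eq\<close>)
  then have "(LINT v:{0<..}|lborel. exp (- (c * of_real v))) = 1 / c"
    by (simp add: interval_lebesgue_integral_0_infty)
  with 1 show ?thesis by (simp add: has_bochner_integral_iff set_integrable_def set_lebesgue_integral_def)
qed

lemma set_integrable_powr_Ioi:
  fixes a :: real
  assumes "a < -1"
  shows "set_integrable lborel {1<..} (\<lambda>v. v powr a)"
proof -
  have "(\<lambda>v. v powr a) integrable_on {1..}"
    using has_integral_powr_to_inf[OF assms zero_less_one] by blast
  then have "(\<lambda>v. v powr a) absolutely_integrable_on {1..}"
    by (rule nonnegative_absolutely_integrable_1) auto
  then have "set_integrable lborel {1..} (\<lambda>v. v powr a)"
    unfolding set_integrable_def by (subst (asm) integrable_completion) auto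
  then show ?thesis by (rule set_integrable_subset) auto
qed

lemma norm_iexp_minus_1_le: "norm (iexp y - 1) \<le> min 2 \<bar>y\<bar>"
  using iexp_approx1[of y 0] iexp_approx2[of y 0] by simp

text \<open>Subtracting \<open>1\<close> makes the integrand of size \<open>v powr (- l)\<close>
  near \<open>0\<close>, while it stays of size \<open>v powr (- 1 - l)\<close> at infinity, so
  convergence is absolute. The value follows by writing \<open>v powr (- 1 - l)\<close> as a Laplace
  transform of a multiple of \<open>u powr l\<close>.\<close>

lemma
  assumes l: "0 < l" "l < 1"
  shows set_integrable_Marchaud:
      "set_integrable lborel {0<..} (\<lambda>v. (iexp (- v) - 1) / of_real (v powr (1 + l)))"
    and set_integral_Marchaud:
      "(LINT v:{0<..}|lborel. (iexp (- v) - 1) / of_real (v powr (1 + l))) = of_real (Gamma (- l)) * cis (pi * l / 2)"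
proof -
  let ?I = "indicator {0<..} :: real \<Rightarrow> real"
  define \<phi> where "\<phi> = (\<lambda>v. (iexp (- v) - 1) / of_real (v powr (1 + l)))"
  have [measurable]: "\<phi> \<in> borel_measurable borel" unfolding \<phi>_def by measurable
  have nm: "norm (\<phi> v) = norm (iexp (- v) - 1) * v powr (- 1 - l)" for v
    using powr_minus_divide[of v "1 + l"] unfolding \<phi>_def norm_divide by simp
  show \<phi>: "set_integrable lborel {0<..} \<phi>"
  proof -
    have "set_integrable lborel {0<..1} \<phi>"
    proof (rule set_integrable_bound)
      show "set_integrable lborel {0<..1} (\<lambda>v. v powr (- l))"
        using l by (intro set_integrable_powr_Ioc) auto
      show "AE v in lborel. v \<in> {0<..1} \<longrightarrow> norm (\<phi> v) \<le> norm (v powr (- l))"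
      proof (intro AE_I2 impI)
        fix v :: real assume v: "v \<in> {0<..1}"
        have "norm (\<phi> v) \<le> v * v powr (- 1 - l)"
          unfolding nm using norm_iexp_minus_1_le[of "-v"] v by (intro mult_right_mono) auto
        also have "\<dots> = v powr (1 + (- 1 - l))" unfolding powr_add using v by simp
        finally show "norm (\<phi> v) \<le> norm (v powr (- l))" by simp
      qed
    qed (auto simp: set_borel_measurable_def)
    moreover have "set_integrable lborel {1<..} \<phi>"
    proof (rule set_integrable_bound)
      show "set_integrable lborel {1<..} (\<lambda>v. 2 * v powr (- 1 - l))"
        using l by (intro set_integrable_mult_right set_integrable_powr_Ioi) auto
      show "AE v in lborel. v \<in> {1<..} \<longrightarrow> norm (\<phi> v) \<le> norm (2 * v powr (- 1 - l))"
      proof (intro AE_I2 impI)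
        fix v :: real
        have "norm (\<phi> v) \<le> 2 * v powr (- 1 - l)"
          unfolding nm using norm_iexp_minus_1_le[of "-v"] by (intro mult_right_mono) auto
        then show "norm (\<phi> v) \<le> norm (2 * v powr (- 1 - l))" by simp
      qed
    qed (auto simp: set_borel_measurable_def)
    ultimately have "set_integrable lborel ({0<..1} \<union> {1<..}) \<phi>"
      by (rule set_integrable_Un) auto
    also have "{0<..(1::real)} \<union> {1<..} = {0<..}" by auto
    finally show ?thesis .
  qed
  define F where "F = (\<lambda>v u. (?I v * (?I u * (u powr ((1 + l) - 1) * exp (- (v * u))))) *\<^sub>R (iexp (- v) - 1))"
  have G: "Gamma (1 + l) > 0" using l by simp
  have inner: "has_bochner_integral lborel (\<lambda>u. ?I v * (?I u * (u powr ((1 + l) - 1) * exp (- (v * u)))))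
      (?I v * (Gamma (1 + l) * v powr (- (1 + l))))" for v
    using l has_bochner_integral_Gamma_scaled[of "1 + l" v]
    by (cases "v > 0") (auto intro!: has_bochner_integral_mult_right)
  have "integrable (lborel \<Otimes>\<^sub>M lborel) (case_prod F)"
  proof (rule lborel_pair.Fubini_integrable)
    show "case_prod F \<in> borel_measurable (lborel \<Otimes>\<^sub>M lborel)"
      unfolding F_def by measurable
    have "(LINT u|lborel. norm (F v u)) = Gamma (1 + l) * norm (?I v *\<^sub>R \<phi> v)" for v
    proof -
      have "(LINT u|lborel. norm (F v u)) = (LINT u|lborel. (?I v * (?I u * (u powr ((1 + l) - 1) * exp (- (v * u))))) * norm (iexp (- v) - 1))"
        unfolding F_def norm_scaleR by (intro Bochner_Integration.integral_cong refl arg_cong2[where f = "(*)"]) (auto simp: indicator_def)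
      also have "\<dots> = (?I v * (Gamma (1 + l) * v powr (- (1 + l)))) * norm (iexp (- v) - 1)"
        using inner[of v] by (simp add: has_bochner_integral_iff)
      finally show ?thesis by (simp add: nm indicator_def)
    qed
    then show "integrable lborel (\<lambda>v. LINT u|lborel. norm (case_prod F (v, u)))"
      using \<phi>[unfolded set_integrable_def, THEN integrable_norm] by simp
    show "AE v in lborel. integrable lborel (\<lambda>u. case_prod F (v, u))"
      using inner unfolding F_def has_bochner_integral_iff by (intro AE_I2) auto
  qed
  then have "(LINT u|lborel. LINT v|lborel. F v u) = (LINT v|lborel. LINT u|lborel. F v u)"
    by (rule lborel_pair.Fubini_integral)
  also have "(\<lambda>v. LINT u|lborel. F v u) = (\<lambda>v. of_real (Gamma (1 + l)) * (?I v *\<^sub>R \<phi> v))"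
  proof
    fix v
    have "(LINT u|lborel. F v u) = (?I v * (Gamma (1 + l) * v powr (- (1 + l)))) *\<^sub>R (iexp (- v) - 1)"
      using inner[of v] unfolding F_def has_bochner_integral_iff by simp
    then show "(LINT u|lborel. F v u) = of_real (Gamma (1 + l)) * (?I v *\<^sub>R \<phi> v)"
      unfolding \<phi>_def powr_minus_divide by (simp add: indicator_def scaleR_conv_of_real)
  qed
  also have "(LINT v|lborel. of_real (Gamma (1 + l)) * (?I v *\<^sub>R \<phi> v)) = of_real (Gamma (1 + l)) * (LINT v:{0<..}|lborel. \<phi> v)"
    unfolding set_lebesgue_integral_def by (rule integral_mult_right_zero)
  also have "(\<lambda>u. LINT v|lborel. F v u) = (\<lambda>u. (- \<i>) * (?I u *\<^sub>R (of_real (u powr (- (1 - l))) / (of_real u + \<i>))))"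
  proof
    fix u :: real
    show "(LINT v|lborel. F v u) = (- \<i>) * (?I u *\<^sub>R (of_real (u powr (- (1 - l))) / (of_real u + \<i>)))"
    proof (cases "u > 0")
      case True
      \<comment> \<open>Here \<open>1 / (u + \<i>) - 1 / u = - \<i> / (u * (u + \<i>))\<close>; the
        extra \<open>u\<close> lowers \<open>u powr l\<close> to \<open>u powr (- (1 - l))\<close>,
        the kernel at \<open>z = 1 - l\<close>.\<close>
      have "has_bochner_integral lborel
        (\<lambda>v. (u powr l) *\<^sub>R (?I v *\<^sub>R exp (- ((of_real u + \<i>) * of_real v)) - ?I v *\<^sub>R exp (- (of_real u * of_real v))))
        ((u powr l) *\<^sub>R (1 / (of_real u + \<i>) - 1 / of_real u))"
        using True by (intro has_bochner_integral_scaleR_right has_bochner_integral_diff has_bochner_integral_cexp_neg) auto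
      also have "(\<lambda>v. (u powr l) *\<^sub>R (?I v *\<^sub>R exp (- ((of_real u + \<i>) * of_real v)) - ?I v *\<^sub>R exp (- (of_real u * of_real v)))) = (\<lambda>v. F v u)"
        using True unfolding F_def
        by (auto simp: indicator_def scaleR_conv_of_real exp_of_real[symmetric] exp_add[symmetric] algebra_simps)
      finally have "(LINT v|lborel. F v u) = (u powr l) *\<^sub>R (1 / (of_real u + \<i>) - 1 / of_real u)"
        by (simp add: has_bochner_integral_iff)
      moreover have "complex_of_real u + \<i> \<noteq> 0" by (auto simp: complex_eq_iff)
      moreover have "u powr l = u powr 1 * u powr (- (1 - l))" unfolding powr_add[symmetric] by simp
      ultimately show ?thesis using True
        by (simp add: scaleR_conv_of_real divide_simps)
    qed (auto simp: F_def)
  qed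
  also have "(LINT u|lborel. (- \<i>) * (?I u *\<^sub>R (of_real (u powr (- (1 - l))) / (of_real u + \<i>)))) =
     (- \<i>) * (of_real (Gamma (1 - l) * Gamma (1 - (1 - l))) * cis (- (pi * (1 - l) / 2)))"
    using has_bochner_integral_powr_over_plus_i[of "1 - l"] l
    by (subst integral_mult_right_zero) (auto simp: has_bochner_integral_iff)
  also have "cis (- (pi * (1 - l) / 2)) = cis (- (pi / 2)) * cis (pi * l / 2)"
    unfolding cis_mult by (simp add: algebra_simps diff_divide_distrib)
  also have "cis (- (pi / 2)) = - \<i>" by (simp add: complex_eq_iff)
  finally have *: "of_real (Gamma (1 + l)) * (LINT v:{0<..}|lborel. \<phi> v) =
      - of_real (Gamma (1 - l) * Gamma l) * cis (pi * l / 2)" by (simp add: mult_ac)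
  \<comment> \<open>The functional equation at \<open>- l\<close> and at \<open>l\<close> turns
    \<open>- Gamma (1 - l) * Gamma l / Gamma (1 + l)\<close> into
    \<open>Gamma (- l)\<close>.\<close>
  have "- l \<notin> \<int>\<^sub>\<le>\<^sub>0" "l \<notin> \<int>\<^sub>\<le>\<^sub>0"
    using l by (auto elim!: nonpos_Ints_cases')
  then have "Gamma (1 - l) = - l * Gamma (- l)" "Gamma (1 + l) = l * Gamma l"
    using Gamma_plus1[of "-l"] Gamma_plus1[of l] by (simp_all add: add.commute)
  with * l G have "Gamma l = 0 \<or> (LINT v:{0<..}|lborel. \<phi> v) = of_real (Gamma (- l)) * cis (pi * l / 2)"
    by simp
  moreover have "Gamma l > 0" using l by simp
  ultimately show "(LINT v:{0<..}|lborel. \<phi> v) = of_real (Gamma (- l)) * cis (pi * l / 2)"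
    by (metis less_irrefl)
qed

section \<open>Powers of \<open>\<i>y\<close>\<close>

text \<open>\<open>ipow r y\<close> is the principal value of \<open>(\<i>y)\<^sup>r\<close>, which equals
  \<open>\<i>\<^sup>r\<close> times the conjugate of \<open>y\<^sup>r\<close>; at \<open>y = 0\<close> it follows the conventions of \<open>cpow\<close>.\<close>

definition ipow :: "real \<Rightarrow> real \<Rightarrow> complex" where
  "ipow r y = (if y = 0 \<and> r = 0 then 1 else of_real (\<bar>y\<bar> powr r) * cis (sgn y * (pi * r / 2)))"

section \<open>Growth and multiplicativity of \<open>ipow\<close>\<close>

lemma ipow_0_left [simp]: "ipow 0 y = 1"
  by (simp add: ipow_def)

lemma ipow_0_right: "r \<noteq> 0 \<Longrightarrow> ipow r 0 = 0"
  by (simp add: ipow_def)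

lemma norm_ipow: "norm (ipow r y) = (if y = 0 \<and> r = 0 then 1 else \<bar>y\<bar> powr r)"
  by (simp add: ipow_def norm_mult)

text \<open>Serves both to lower the order of a finite moment and as a majorant uniform in
  \<open>q\<close>: a power with exponent between \<open>0\<close> and \<open>r\<close> is at most
  the larger of \<open>1\<close> and \<open>\<bar>y\<bar> powr r\<close>.\<close>

lemma norm_ipow_le: "norm (ipow q y) \<le> 1 + norm (ipow r y)"
  if "0 \<le> q \<and> q \<le> r \<or> r \<le> q \<and> q \<le> 0"
proof (cases "y = 0 \<or> q = 0")
  case True
  then show ?thesis by (auto simp: norm_ipow)
next
  case False
  show ?thesis
  \<comment> \<open>The equivalence selects \<open>\<bar>y\<bar> \<ge> 1\<close> with
    \<open>q > 0\<close> and \<open>\<bar>y\<bar> < 1\<close> with \<open>q < 0\<close>, where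
    moving the exponent from \<open>q\<close> to \<open>r\<close> cannot decrease the power;
    otherwise the power is at most \<open>1\<close>.\<close>
  proof (cases "\<bar>y\<bar> \<ge> 1 \<longleftrightarrow> q > 0")
    case True
    then have "\<bar>y\<bar> powr q \<le> \<bar>y\<bar> powr r"
      using that False powr_mono'[of r q "\<bar>y\<bar>"] by (cases "q > 0") (auto intro: powr_mono)
    with False show ?thesis by (simp add: norm_ipow)
  next
    case 2: False
    have "\<bar>y\<bar> powr q \<le> 1"
    proof (cases "q > 0")
      case True
      with 2 show ?thesis by (intro powr_le1) auto
    next
      case F: False
      with 2 have "\<bar>y\<bar> powr q \<le> \<bar>y\<bar> powr 0" by (intro powr_mono) auto
      then show ?thesis using False by simp
    qed
    with False show ?thesis by (simp add: norm_ipow add_increasing2)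
  qed
qed

text \<open>At \<open>y = 0\<close> this fails for \<open>a + b = 0\<close> with
  \<open>a \<noteq> 0\<close>: the left side is \<open>0\<close>, the right side \<open>1\<close>.
  Negative orders are therefore treated almost everywhere.\<close>

lemma ipow_add: "y \<noteq> 0 \<Longrightarrow> ipow a y * ipow b y = ipow (a + b) y"
  by (simp add: ipow_def powr_add cis_mult[symmetric] add_divide_distrib distrib_left)

lemma ipow_of_nat: "ipow (real n) y = (\<i> * of_real y) ^ n"
proof (cases "y = 0")
  case False
  have "(\<i> * of_real y) ^ n = (of_real \<bar>y\<bar> * cis (sgn y * (pi / 2))) ^ n"
    using False by (intro arg_cong2[where f = power]) (auto simp: complex_eq_iff sgn_real_def)
  also have "\<dots> = of_real (\<bar>y\<bar> ^ n) * cis (real n * (sgn y * (pi / 2)))"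
    by (simp add: power_mult_distrib Complex.DeMoivre)
  finally show ?thesis using False by (simp add: ipow_def powr_realpow mult_ac)
qed (simp add: ipow_def)

lemma ipow_uminus: "ipow r (- y) = cnj (ipow r y)"
  by (simp add: ipow_def cis_cnj)

lemma cpow_ii: "cpow \<i> r = cis (pi * r / 2)"
  by (simp add: cpow_def powr_def cis_conv_exp mult_ac)

text \<open>A negative \<open>y\<close> has principal argument \<open>pi\<close>; conjugation gives
  the angle \<open>- (r * pi)\<close>, and the factor \<open>cpow \<i> r = cis (pi * r / 2)\<close>
  brings it to \<open>- (pi * r / 2)\<close>, the angle of \<open>(\<i> * y)\<close> to the power
  \<open>r\<close>. Hence the conjugated power in the theorem.\<close>

lemma ipow_eq_cpow: "cpow \<i> r * cnj (cpow (of_real y) r) = ipow r y"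
proof -
  consider "y > 0" | "y < 0" | "y = 0" by linarith
  then show ?thesis
  proof cases
    case 1
    then show ?thesis by (simp add: cpow_ii) (simp add: cpow_def ipow_def powr_of_real)
  next
    case 2
    then have "Ln (of_real y) = of_real (ln \<bar>y\<bar>) + \<i> * of_real pi"
      using Ln_of_real'[of y] by (simp add: Ln_of_real)
    then have "cpow (of_real y) r = exp (of_real (r * ln \<bar>y\<bar>) + \<i> * of_real (r * pi))"
      using 2 by (simp add: cpow_def powr_def algebra_simps)
    also have "\<dots> = of_real (\<bar>y\<bar> powr r) * cis (r * pi)"
      using 2 by (simp only: exp_add exp_of_real cis_conv_exp) (simp add: powr_def)
    finally have "cpow \<i> r * cnj (cpow (of_real y) r) = of_real (\<bar>y\<bar> powr r) * (cis (pi * r / 2) * cis (- (r * pi)))"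
      by (simp add: cpow_ii cis_cnj)
    also have "cis (pi * r / 2) * cis (- (r * pi)) = cis (- (pi * r / 2))"
      unfolding cis_mult by (rule arg_cong[where f = cis]) (simp add: field_simps)
    finally show ?thesis using 2 by (simp add: ipow_def)
  next
    case 3
    then show ?thesis by (simp add: cpow_ii) (simp add: cpow_def ipow_def)
  qed
qed

lemma borel_measurable_ipow [measurable]: "ipow r \<in> borel_measurable borel"
  unfolding ipow_def cis_conv_exp sgn_real_def by measurable

section \<open>Scaling the kernel integrals to frequency \<open>y\<close>\<close>

text \<open>The measure \<open>dv / v powr (1 + l)\<close> is homogeneous of degree
  \<open>- l\<close>, so replacing \<open>v\<close> by \<open>y * v\<close> produces the factor
  \<open>y powr l\<close> for \<open>y > 0\<close>; conjugation covers \<open>y < 0\<close>.\<close>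

lemma has_bochner_integral_Marchaud_scaled:
  fixes l y :: real
  assumes l: "0 < l" "l < 1"
  shows "has_bochner_integral lborel
    (\<lambda>v. indicator {0<..} v *\<^sub>R ((iexp (- (v * y)) - 1) / of_real (v powr (1 + l)))) (of_real (Gamma (- l)) * ipow l y)"
proof -
  define h where "h = (\<lambda>y v. indicator {0<..} v *\<^sub>R ((iexp (- (v * y)) - 1) / of_real (v powr (1 + l))))"
  have h1: "has_bochner_integral lborel (h 1) (of_real (Gamma (- l)) * ipow l 1)"
    using set_integrable_Marchaud[OF l] set_integral_Marchaud[OF l]
    by (simp add: has_bochner_integral_iff set_integrable_def set_lebesgue_integral_def h_def ipow_def)
  have pos: "has_bochner_integral lborel (h y) (of_real (Gamma (- l)) * ipow l y)" if "y > 0" for y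
  proof -
    have "has_bochner_integral lborel (\<lambda>v. h 1 (0 + y * v)) ((of_real (Gamma (- l)) * ipow l 1) /\<^sub>R \<bar>y\<bar>)"
      using h1 that by (subst (asm) lborel_has_bochner_integral_real_affine_iff[of y _ _ 0]) auto
    then have "has_bochner_integral lborel (\<lambda>v. (y powr (1 + l)) *\<^sub>R h 1 (0 + y * v)) 
       ((y powr (1 + l)) *\<^sub>R ((of_real (Gamma (- l)) * ipow l 1) /\<^sub>R \<bar>y\<bar>))"
      by (intro has_bochner_integral_scaleR_right)
    also have "(\<lambda>v. (y powr (1 + l)) *\<^sub>R h 1 (0 + y * v)) = h y"
      using that by (auto simp: h_def fun_eq_iff indicator_def zero_less_mult_iff powr_mult scaleR_conv_of_real mult_ac)
    also have "(y powr (1 + l)) *\<^sub>R ((of_real (Gamma (- l)) * ipow l 1) /\<^sub>R \<bar>y\<bar>) = of_real (Gamma (- l)) * ipow l y"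
      using that by (simp add: ipow_def powr_add scaleR_conv_of_real)
    finally show ?thesis .
  qed
  have "has_bochner_integral lborel (h y) (of_real (Gamma (- l)) * ipow l y)" for y
  proof -
    consider "y > 0" | "y < 0" | "y = 0" by linarith
    then show ?thesis
    proof cases
      case 2
      then have "has_bochner_integral lborel (\<lambda>v. cnj (h (- y) v)) (cnj (of_real (Gamma (- l)) * ipow l (- y)))"
        by (intro has_bochner_integral_bounded_linear[OF bounded_linear_cnj] pos) auto
      moreover have "(\<lambda>v. cnj (h (- y) v)) = h y"
        by (simp add: h_def fun_eq_iff exp_cnj)
      ultimately show ?thesis by (simp add: ipow_uminus)
    next
      case 3
      have "h 0 = (\<lambda>_. 0)" by (simp add: h_def fun_eq_iff)
      with 3 l show ?thesis by (simp add: ipow_0_right has_bochner_integral_zero)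
    qed (rule pos)
  qed
  then show ?thesis unfolding h_def .
qed

text \<open>Supplies the Fubini hypothesis of \<open>fourier_Marchaud\<close>: by the same scaling,
  \<open>C\<close> is the integral at \<open>y = 1\<close>.\<close>

lemma integral_norm_Marchaud_scaled:
  fixes l :: real
  assumes l: "0 < l" "l < 1"
  shows "\<exists>C. \<forall>y. (LINT v|lborel. norm (indicator {0<..} v *\<^sub>R ((iexp (- (v * y)) - 1) / of_real (v powr (1 + l))))) = C * \<bar>y\<bar> powr l"
proof -
  define h where "h = (\<lambda>y v. norm (indicator {0<..} v *\<^sub>R ((iexp (- (v * y)) - 1) / of_real (v powr (1 + l)))))"
  have pos: "(LINT v|lborel. h y v) = (LINT v|lborel. h 1 v) * \<bar>y\<bar> powr l" if "y > 0" for y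
  proof -
    have "(LINT v|lborel. h 1 v) = \<bar>y\<bar> *\<^sub>R (LINT v|lborel. h 1 (0 + y * v))"
      using that by (intro lborel_integral_real_affine) auto
    also have "(\<lambda>v. h 1 (0 + y * v)) = (\<lambda>v. y powr (- (1 + l)) * h y v)"
      using that unfolding powr_minus_divide
      by (auto simp: h_def fun_eq_iff indicator_def zero_less_mult_iff powr_mult norm_divide norm_mult mult_ac)
    also have "\<bar>y\<bar> *\<^sub>R (LINT v|lborel. y powr (- (1 + l)) * h y v) = (y powr 1 * y powr (- (1 + l))) * (LINT v|lborel. h y v)"
      using that by simp
    also have "y powr 1 * y powr (- (1 + l)) = y powr (- l)"
      unfolding powr_add[symmetric] by simp
    finally show ?thesis using that by (simp add: powr_minus_divide)
  qed
  have "(LINT v|lborel. h y v) = (LINT v|lborel. h 1 v) * \<bar>y\<bar> powr l" for y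
  proof -
    consider "y > 0" | "y < 0" | "y = 0" by linarith
    then show ?thesis
    proof cases
      case 2
      have "h y v = h (- y) v" for v
      proof -
        have "norm (iexp (- (v * y)) - 1) = norm (cnj (iexp (- (v * - y)) - 1))"
          by (simp add: exp_cnj)
        then show ?thesis unfolding h_def complex_mod_cnj by (simp add: norm_divide)
      qed
      then have "h y = h (- y)" by auto
      with 2 pos[of "- y"] show ?thesis by simp
    next
      case 3
      have "h 0 = (\<lambda>_. 0)" by (simp add: h_def fun_eq_iff)
      with 3 l show ?thesis by simp
    qed (rule pos)
  qed
  then show ?thesis unfolding h_def by blast
qed

text \<open>Scaling moves the cut-off from \<open>T\<close> to \<open>\<bar>y\<bar> * T\<close>, so
  a bound on \<open>osc\<close> uniform in the cut-off is uniform in \<open>y\<close> as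
  well.\<close>

lemma osc_scaled:
  fixes s y T :: real
  assumes "y \<noteq> 0"
  shows "(LINT v:{0<..T}|lborel. iexp (- (v * y)) / of_real (v powr (1 + s)))
    = of_real (\<bar>y\<bar> powr s) * (if y > 0 then osc (- s) (\<bar>y\<bar> * T) else cnj (osc (- s) (\<bar>y\<bar> * T)))"
proof -
  define h where "h = (\<lambda>y v. indicator {0<..T} v *\<^sub>R (iexp (- (v * y)) / of_real (v powr (1 + s))))"
  have pos: "(LINT v|lborel. h y v) = of_real (y powr s) * osc (- s) (y * T)" if "y > 0" for y
  proof -
    have "osc (- s) (y * T) = \<bar>y\<bar> *\<^sub>R (LINT v|lborel. indicator {0<..y * T} (0 + y * v) *\<^sub>R (iexp (- (0 + y * v)) / of_real ((0 + y * v) powr (1 - (- s)))))"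
      unfolding osc_def set_lebesgue_integral_def
      using that by (intro lborel_integral_real_affine) auto
    also have "(\<lambda>v. indicator {0<..y * T} (0 + y * v) *\<^sub>R (iexp (- (0 + y * v)) / of_real ((0 + y * v) powr (1 - (- s)))))
      = (\<lambda>v. (y powr (- (1 + s))) *\<^sub>R h y v)"
      using that unfolding powr_minus_divide
      by (auto simp: h_def fun_eq_iff indicator_def zero_less_mult_iff powr_mult scaleR_conv_of_real mult_ac)
    also have "\<bar>y\<bar> *\<^sub>R (LINT v|lborel. (y powr (- (1 + s))) *\<^sub>R h y v) = (y powr 1 * y powr (- (1 + s))) *\<^sub>R (LINT v|lborel. h y v)"
      using that by simp
    also have "y powr 1 * y powr (- (1 + s)) = y powr (- s)"
      unfolding powr_add[symmetric] by simp
    finally show ?thesis using that by (simp add: powr_minus scaleR_conv_of_real)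
  qed
  show ?thesis
  proof (cases "y > 0")
    case True
    with pos[of y] show ?thesis by (simp add: h_def set_lebesgue_integral_def)
  next
    case False
    have "(LINT v|lborel. h y v) = (LINT v|lborel. cnj (h (- y) v))"
      by (simp add: h_def exp_cnj)
    also have "\<dots> = cnj (LINT v|lborel. h (- y) v)" by (rule Bochner_Integration.integral_cnj)
    finally show ?thesis using False assms pos[of "- y"] by (simp add: h_def set_lebesgue_integral_def)
  qed
qed

section \<open>Fourier transforms of weighted distributions\<close>

text \<open>Limits at a real point reduce to sequences avoiding it. Three limits rely on this:
  difference quotients, orders decreasing to a negative integer, and the lower cut-off going to
  \<open>0\<close>.\<close>

lemma integral_dominated_convergence_at:
  fixes s :: "real \<Rightarrow> 'a \<Rightarrow> 'b::{banach, second_countable_topology}"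
  assumes "f \<in> borel_measurable M" "\<And>h. s h \<in> borel_measurable M" "integrable M w"
    and lim: "AE x in M. ((\<lambda>h. s h x) \<longlongrightarrow> f x) (at a within S)"
    and bound: "\<And>h. h \<in> S \<Longrightarrow> h \<noteq> a \<Longrightarrow> AE x in M. norm (s h x) \<le> w x"
  shows "((\<lambda>h. integral\<^sup>L M (s h)) \<longlongrightarrow> integral\<^sup>L M f) (at a within S)"
  unfolding tendsto_at_iff_sequentially comp_def
proof (intro allI impI)
  fix X assume X: "\<forall>i. X i \<in> S - {a}" "X \<longlonglongrightarrow> a"
  show "(\<lambda>n. integral\<^sup>L M (s (X n))) \<longlonglongrightarrow> integral\<^sup>L M f"
  proof (rule integral_dominated_convergence)
    show "AE x in M. (\<lambda>i. s (X i) x) \<longlonglongrightarrow> f x"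
      using lim
    proof eventually_elim
      case (elim x)
      then show ?case using X unfolding tendsto_at_iff_sequentially comp_def by blast
    qed
    show "AE x in M. norm (s (X i) x) \<le> w x" for i
      using X by (intro bound) auto
  qed (use assms in auto)
qed

lemma has_vector_derivative_at_iff_quotient:
  fixes f :: "real \<Rightarrow> 'a::real_normed_vector"
  shows "(f has_vector_derivative D) (at t) \<longleftrightarrow> ((\<lambda>h. (f (t + h) - f t) /\<^sub>R h) \<longlongrightarrow> D) (at 0)"
proof -
  have "norm (f (t + h) - f t - h *\<^sub>R D) / norm h = norm ((f (t + h) - f t) /\<^sub>R h - D)" if "h \<noteq> 0" for h
  proof -
    have "f (t + h) - f t - h *\<^sub>R D = h *\<^sub>R ((f (t + h) - f t) /\<^sub>R h - D)"
      using that by (simp add: scaleR_diff_right)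
    then show ?thesis using that by simp
  qed
  then have "(\<lambda>h. norm (f (t + h) - f t - h *\<^sub>R D) / norm h) \<midarrow>0\<rightarrow> 0 \<longleftrightarrow>
     (\<lambda>h. norm ((f (t + h) - f t) /\<^sub>R h - D)) \<midarrow>0\<rightarrow> 0"
    by (intro LIM_cong) auto
  then show ?thesis
    unfolding has_vector_derivative_def has_derivative_at tendsto_norm_zero_iff LIM_zero_iff
    by (auto intro: bounded_linear_scaleR_left)
qed

text \<open>The Fourier transform of the complex measure with density \<open>g\<close> relative to
  \<open>N\<close>. Derivatives of every order only multiply \<open>g\<close> by a power of
  \<open>\<i> * y\<close>.\<close>

definition fourier :: "real measure \<Rightarrow> (real \<Rightarrow> complex) \<Rightarrow> real \<Rightarrow> complex" where
  "fourier N g t = (LINT y|N. g y * iexp (t * y))"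

lemma iexp_diff_mult: "g * iexp ((t - v) * y) = g * iexp (t * y) * iexp (- (v * y))"
  by (simp add: left_diff_distrib exp_diff exp_minus field_simps)

section \<open>Derivatives of integer and fractional order acting on Fourier integrals\<close>

context real_distribution
begin

lemma integrable_mult_iexp:
  assumes "integrable M g"
  shows "integrable M (\<lambda>y. g y * iexp (t * y))"
  by (rule Bochner_Integration.integrable_bound[OF assms]) (use assms in \<open>auto simp: norm_mult\<close>)

lemma fourier_diff:
  assumes "integrable M g"
  shows "fourier M g (t - v) - fourier M g t = (LINT y|M. g y * iexp (t * y) * (iexp (- (v * y)) - 1))"
proof -
  have "fourier M g (t - v) - fourier M g t = (LINT y|M. g y * iexp ((t - v) * y) - g y * iexp (t * y))"
    unfolding fourier_def
    by (intro Bochner_Integration.integral_diff[symmetric] integrable_mult_iexp assms)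
  then show ?thesis unfolding iexp_diff_mult by (simp add: algebra_simps)
qed

text \<open>Differentiation under the integral: the quotient \<open>(iexp (h * y) - 1) / h\<close>
  tends to \<open>\<i> * y\<close> and is bounded by \<open>\<bar>y\<bar>\<close>, so
  \<open>norm (of_real y * g y)\<close> is a majorant.\<close>

lemma has_vector_derivative_fourier:
  assumes g: "integrable M g" and yg: "integrable M (\<lambda>y. of_real y * g y)"
  shows "(fourier M g has_vector_derivative fourier M (\<lambda>y. \<i> * of_real y * g y) t) (at t)"
proof -
  have [measurable]: "g \<in> borel_measurable M" using g by auto
  define s where "s = (\<lambda>h y. g y * iexp (t * y) * ((iexp (h * y) - 1) / of_real h))"
  have "((\<lambda>h. LINT y|M. s h y) \<longlongrightarrow> (LINT y|M. \<i> * of_real y * g y * iexp (t * y))) (at 0)"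
  proof (rule integral_dominated_convergence_at[where w = "\<lambda>y. norm (of_real y * g y)"])
    show "AE y in M. ((\<lambda>h. s h y) \<longlongrightarrow> \<i> * of_real y * g y * iexp (t * y)) (at 0)"
    proof (rule AE_I2)
      fix y :: real
      have "((\<lambda>h. iexp (h * y)) has_vector_derivative (\<i> * of_real y)) (at 0)"
        by (auto intro!: derivative_eq_intros has_vector_derivative_real_field)
      then have "((\<lambda>h. (iexp (h * y) - 1) / of_real h) \<longlongrightarrow> \<i> * of_real y) (at 0)"
        unfolding has_vector_derivative_at_iff_quotient
        by (simp add: scaleR_conv_of_real divide_inverse mult.commute)
      then have "((\<lambda>h. s h y) \<longlongrightarrow> g y * iexp (t * y) * (\<i> * of_real y)) (at 0)"
        unfolding s_def by (intro tendsto_intros)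
      then show "((\<lambda>h. s h y) \<longlongrightarrow> \<i> * of_real y * g y * iexp (t * y)) (at 0)"
        by (simp add: mult_ac)
    qed
    show "AE y in M. norm (s h y) \<le> norm (of_real y * g y)" if "h \<noteq> 0" for h
    proof (rule AE_I2)
      fix y :: real
      have "norm (iexp (h * y) - 1) \<le> \<bar>h\<bar> * \<bar>y\<bar>"
        using norm_iexp_minus_1_le[of "h * y"] by (simp add: abs_mult)
      then have "norm ((iexp (h * y) - 1) / of_real h) \<le> \<bar>y\<bar>"
        using that by (simp add: norm_divide field_simps)
      from mult_left_mono[OF this norm_ge_zero[of "g y"]]
      show "norm (s h y) \<le> norm (of_real y * g y)"
        unfolding s_def norm_mult by (simp add: mult.commute)
    qed
  qed (use yg in \<open>auto simp: s_def\<close>)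
  moreover have "(LINT y|M. s h y) = (fourier M g (t + h) - fourier M g t) /\<^sub>R h" for h
    using fourier_diff[OF g, of t "- h"] unfolding s_def
    by (simp add: scaleR_conv_of_real divide_inverse mult.commute[of "inverse _"] flip: mult.assoc)
  ultimately have "((\<lambda>h. (fourier M g (t + h) - fourier M g t) /\<^sub>R h) \<longlongrightarrow> fourier M (\<lambda>y. \<i> * of_real y * g y) t) (at 0)"
    by (simp add: fourier_def)
  then show ?thesis unfolding has_vector_derivative_at_iff_quotient .
qed

text \<open>The operator multiplies each exponential \<open>iexp (t * y)\<close> by
  \<open>ipow l y\<close>. Fubini carries this over to the mixture: the modulus integrates over
  \<open>v\<close> to \<open>norm (g y) * (C * \<bar>y\<bar> powr l)\<close>, integrable by
  \<open>gl\<close>.\<close>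

lemma fourier_Marchaud:
  assumes l: "0 < l" "l < 1"
    and g: "integrable M g" and gl: "integrable M (\<lambda>y. norm (g y) * \<bar>y\<bar> powr l)"
  shows "of_real (1 / Gamma (- l)) *
      (LINT v:{0<..}|lborel. (fourier M g (t - v) - fourier M g t) / of_real (v powr (1 + l)))
    = fourier M (\<lambda>y. g y * ipow l y) t"
proof -
  have [measurable]: "g \<in> borel_measurable M" using g by auto
  interpret P: pair_sigma_finite M lborel ..
  define F where "F = (\<lambda>y v. g y * iexp (t * y) * (indicator {0<..} v *\<^sub>R ((iexp (- (v * y)) - 1) / of_real (v powr (1 + l)))))"
  obtain C where C: "\<And>y. (LINT v|lborel. norm (indicator {0<..} v *\<^sub>R ((iexp (- (v * y)) - 1) / of_real (v powr (1 + l))))) = C * \<bar>y\<bar> powr l"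
    using integral_norm_Marchaud_scaled[OF l] by blast
  have "integrable (M \<Otimes>\<^sub>M lborel) (case_prod F)"
  proof (rule P.Fubini_integrable)
    show "case_prod F \<in> borel_measurable (M \<Otimes>\<^sub>M lborel)"
      unfolding F_def by measurable
    have "(LINT v|lborel. norm (F y v)) = norm (g y) * (C * \<bar>y\<bar> powr l)" for y
      unfolding F_def norm_mult by (simp add: C[symmetric])
    then show "integrable M (\<lambda>y. LINT v|lborel. norm (case_prod F (y, v)))"
      using integrable_mult_right[OF gl, of C] by (simp add: mult_ac)
    show "AE y in M. integrable lborel (\<lambda>v. case_prod F (y, v))"
      using has_bochner_integral_Marchaud_scaled[OF l]
      unfolding F_def has_bochner_integral_iff prod.case by (intro AE_I2 integrable_mult_right) blast
  qed
  then have "(LINT v|lborel. LINT y|M. F y v) = (LINT y|M. LINT v|lborel. F y v)"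
    by (rule P.Fubini_integral)
  also have "(\<lambda>y. LINT v|lborel. F y v) = (\<lambda>y. of_real (Gamma (- l)) * (g y * ipow l y * iexp (t * y)))"
  proof
    fix y
    have "(LINT v|lborel. F y v) = g y * iexp (t * y) * (of_real (Gamma (- l)) * ipow l y)"
      unfolding F_def has_bochner_integral_integral_eq[OF has_bochner_integral_Marchaud_scaled[OF l], symmetric]
      by (rule integral_mult_right_zero)
    then show "(LINT v|lborel. F y v) = of_real (Gamma (- l)) * (g y * ipow l y * iexp (t * y))"
      by (simp add: mult_ac)
  qed
  also have "(LINT y|M. of_real (Gamma (- l)) * (g y * ipow l y * iexp (t * y))) = of_real (Gamma (- l)) * fourier M (\<lambda>y. g y * ipow l y) t"
    unfolding fourier_def by (rule integral_mult_right_zero)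
  also have "(\<lambda>v. LINT y|M. F y v) = (\<lambda>v. indicator {0<..} v *\<^sub>R ((fourier M g (t - v) - fourier M g t) / of_real (v powr (1 + l))))"
  proof
    fix v :: real
    have "(LINT y|M. F y v) = (LINT y|M. (g y * iexp (t * y) * (iexp (- (v * y)) - 1)) * (indicator {0<..} v / of_real (v powr (1 + l))))"
      unfolding F_def by (intro Bochner_Integration.integral_cong) (auto simp: indicator_def)
    also have "\<dots> = (LINT y|M. (g y * iexp (t * y) * (iexp (- (v * y)) - 1))) * (indicator {0<..} v / of_real (v powr (1 + l)))"
      by (rule integral_mult_left_zero)
    finally show "(LINT y|M. F y v) = indicator {0<..} v *\<^sub>R ((fourier M g (t - v) - fourier M g t) / of_real (v powr (1 + l)))"
      unfolding fourier_diff[OF g] by (simp add: indicator_def)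
  qed
  finally have *: "(LINT v:{0<..}|lborel. (fourier M g (t - v) - fourier M g t) / of_real (v powr (1 + l)))
     = of_real (Gamma (- l)) * fourier M (\<lambda>y. g y * ipow l y) t"
    unfolding set_lebesgue_integral_def .
  \<comment> \<open>\<open>Gamma\<close> has the value \<open>0\<close> exactly at its poles;
    \<open>- l\<close> lies strictly between two of them, so the prefactor cancels.\<close>
  have "- l \<notin> \<int>\<^sub>\<le>\<^sub>0" using l by (auto elim!: nonpos_Ints_cases')
  then have "Gamma (- l) \<noteq> 0" by (simp add: Gamma_eq_zero_iff)
  with * show ?thesis by simp
qed

text \<open>The \<open>v\<close>-integral converges only conditionally, so Fubini is applied for
  each finite \<open>T\<close>, which is then sent to infinity by dominated convergence. A point
  mass at \<open>0\<close> must be excluded: there the truncated kernel integral grows without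
  bound.\<close>

lemma fourier_Weyl:
  assumes s: "-1 < s" "s < 0" and ae: "AE y in M. y \<noteq> 0"
    and g: "integrable M g" and gs: "integrable M (\<lambda>y. norm (g y) * \<bar>y\<bar> powr s)"
  shows "neg_frac_deriv s (fourier M g) t = fourier M (\<lambda>y. g y * ipow s y) t"
proof -
  have [measurable]: "g \<in> borel_measurable M" using g by auto
  interpret P: pair_sigma_finite M lborel ..
  define h where "h = (\<lambda>T y. g y * iexp (t * y) * (LINT v:{0<..T}|lborel. iexp (- (v * y)) / of_real (v powr (1 + s))))"
  have [measurable]: "h T \<in> borel_measurable M" for T
    unfolding h_def set_lebesgue_integral_def by measurable
  have eq: "(LINT v:{0<..T}|lborel. fourier M g (t - v) / of_real (v powr (1 + s))) = (LINT y|M. h T y)" if "T > 0" for T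
  proof -
    define F where "F = (\<lambda>y v. (g y * iexp (t * y)) * (indicator {0<..T} v *\<^sub>R (iexp (- (v * y)) / of_real (v powr (1 + s)))))"
    have int: "integrable lborel (\<lambda>v. indicator {0<..T} v * v powr (- (1 + s)))"
      using set_integrable_powr_Ioc[of "- (1 + s)" T] s that by (simp add: set_integrable_def)
    have "integrable (M \<Otimes>\<^sub>M lborel) (case_prod F)"
    proof (rule P.Fubini_integrable)
      show "case_prod F \<in> borel_measurable (M \<Otimes>\<^sub>M lborel)"
        unfolding F_def by measurable
      have nF: "norm (F y v) = norm (g y) * (indicator {0<..T} v * v powr (- (1 + s)))" for y v
        unfolding F_def norm_mult powr_minus_divide by (simp add: norm_divide)
      show "integrable M (\<lambda>y. LINT v|lborel. norm (case_prod F (y, v)))"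
        unfolding prod.case nF using g by simp
      show "AE y in M. integrable lborel (\<lambda>v. case_prod F (y, v))"
      proof (rule AE_I2)
        fix y
        show "integrable lborel (\<lambda>v. case_prod F (y, v))"
          by (rule Bochner_Integration.integrable_bound[OF integrable_mult_right[OF int, of "norm (g y)"]])
            (simp_all only: prod.case nF, simp_all add: F_def)
      qed
    qed
    then have "(LINT v|lborel. LINT y|M. F y v) = (LINT y|M. LINT v|lborel. F y v)"
      by (rule P.Fubini_integral)
    also have "(\<lambda>y. LINT v|lborel. F y v) = h T"
      unfolding F_def h_def set_lebesgue_integral_def by (intro ext integral_mult_right_zero)
    also have "(\<lambda>v. LINT y|M. F y v) = (\<lambda>v. indicator {0<..T} v *\<^sub>R (fourier M g (t - v) / of_real (v powr (1 + s))))"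
    proof
      fix v :: real
      have "(LINT y|M. F y v) = (LINT y|M. g y * iexp ((t - v) * y) * (indicator {0<..T} v / of_real (v powr (1 + s))))"
        unfolding F_def iexp_diff_mult by (intro Bochner_Integration.integral_cong) (auto simp: indicator_def)
      also have "\<dots> = (LINT y|M. g y * iexp ((t - v) * y)) * (indicator {0<..T} v / of_real (v powr (1 + s)))"
        by (rule integral_mult_left_zero)
      finally show "(LINT y|M. F y v) = indicator {0<..T} v *\<^sub>R (fourier M g (t - v) / of_real (v powr (1 + s)))"
        unfolding fourier_def by (simp add: indicator_def)
    qed
    finally show ?thesis unfolding set_lebesgue_integral_def .
  qed
  \<comment> \<open>The uniform bound on \<open>osc\<close> provides the majorant
    \<open>B * (norm (g y) * \<bar>y\<bar> powr s)\<close>, integrable by \<open>gs\<close>.\<close>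
  obtain B where B: "\<And>T. norm (osc (- s) T) \<le> B"
    using osc_bounded[of "- s"] s by auto
  have h_eq: "h T y = g y * iexp (t * y) * (of_real (\<bar>y\<bar> powr s) * (if y > 0 then osc (- s) (\<bar>y\<bar> * T) else cnj (osc (- s) (\<bar>y\<bar> * T))))"
    if "y \<noteq> 0" for T y
    unfolding h_def osc_scaled[OF that] ..
  have "((\<lambda>T. LINT y|M. h T y) \<longlongrightarrow> (LINT y|M. of_real (Gamma (- s)) * (g y * ipow s y * iexp (t * y)))) at_top"
  proof (rule integral_dominated_convergence_at_top[where w = "\<lambda>y. B * (norm (g y) * \<bar>y\<bar> powr s)"])
    show "\<forall>\<^sub>F T in at_top. AE y in M. norm (h T y) \<le> B * (norm (g y) * \<bar>y\<bar> powr s)"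
    proof (rule always_eventually, rule allI)
      fix T
      show "AE y in M. norm (h T y) \<le> B * (norm (g y) * \<bar>y\<bar> powr s)"
        using ae
      proof eventually_elim
        case (elim y)
        then show ?case using B[of "\<bar>y\<bar> * T"]
          by (auto simp: h_eq norm_mult mult.commute[of B] mult.assoc intro!: mult_left_mono)
      qed
    qed
    show "AE y in M. ((\<lambda>T. h T y) \<longlongrightarrow> of_real (Gamma (- s)) * (g y * ipow s y * iexp (t * y))) at_top"
      using ae
    proof eventually_elim
      case (elim y)
      have "LIM T at_top. \<bar>y\<bar> * T :> at_top"
        using elim by (intro filterlim_tendsto_pos_mult_at_top[OF tendsto_const]) (auto intro: filterlim_ident)
      then have 1: "((\<lambda>T. osc (- s) (\<bar>y\<bar> * T)) \<longlongrightarrow> of_real (Gamma (- s)) * cis (pi * s / 2)) at_top"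
        using filterlim_compose[OF osc_tendsto[of "- s"]] s by simp
      then have 2: "((\<lambda>T. cnj (osc (- s) (\<bar>y\<bar> * T))) \<longlongrightarrow> cnj (of_real (Gamma (- s)) * cis (pi * s / 2))) at_top"
        by (rule tendsto_cnj)
      show ?case
      proof (cases "y > 0")
        case True
        have "((\<lambda>T. h T y) \<longlongrightarrow> g y * iexp (t * y) * (of_real (\<bar>y\<bar> powr s) * (of_real (Gamma (- s)) * cis (pi * s / 2)))) at_top"
          unfolding h_eq[OF elim] if_P[OF True] by (intro tendsto_intros 1)
        then show ?thesis using True by (simp add: ipow_def mult_ac)
      next
        case False
        have "((\<lambda>T. h T y) \<longlongrightarrow> g y * iexp (t * y) * (of_real (\<bar>y\<bar> powr s) * cnj (of_real (Gamma (- s)) * cis (pi * s / 2)))) at_top"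
          unfolding h_eq[OF elim] if_not_P[OF False] by (intro tendsto_intros 2)
        then show ?thesis using False elim by (simp add: ipow_def cis_cnj mult_ac)
      qed
    qed
    show "integrable M (\<lambda>y. B * (norm (g y) * \<bar>y\<bar> powr s))" using gs by simp
  qed auto
  also have "(LINT y|M. of_real (Gamma (- s)) * (g y * ipow s y * iexp (t * y))) = of_real (Gamma (- s)) * fourier M (\<lambda>y. g y * ipow s y) t"
    unfolding fourier_def by (rule integral_mult_right_zero)
  finally have "((\<lambda>T. LINT v:{0<..T}|lborel. fourier M g (t - v) / of_real (v powr (1 + s))) \<longlongrightarrow> of_real (Gamma (- s)) * fourier M (\<lambda>y. g y * ipow s y) t) at_top"
    by (rule Lim_transform_eventually) 
      (use eventually_gt_at_top[of 0] in \<open>eventually_elim, simp add: eq\<close>)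
  then have "Lim at_top (\<lambda>T. LINT v:{0<..T}|lborel. fourier M g (t - v) / of_real (v powr (1 + s))) = of_real (Gamma (- s)) * fourier M (\<lambda>y. g y * ipow s y) t"
    by (intro tendsto_Lim) auto
  moreover have "Gamma (- s) > 0" using s by simp
  ultimately show ?thesis unfolding neg_frac_deriv_def by simp
qed

end

section \<open>Fractional derivatives of characteristic functions\<close>

context real_distribution
begin

section \<open>Natural and positive fractional orders\<close>

lemma char_eq_fourier: "char M = fourier M (\<lambda>_. 1)"
  by (simp add: char_def fourier_def fun_eq_iff)

lemma integrable_ipow_mono:
  assumes "integrable M (ipow r)" "0 \<le> q \<and> q \<le> r \<or> r \<le> q \<and> q \<le> 0"
  shows "integrable M (ipow q)"
proof (rule Bochner_Integration.integrable_bound)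
  show "integrable M (\<lambda>y. 1 + norm (ipow r y))"
    using assms(1) by auto
  show "AE y in M. norm (ipow q y) \<le> norm (1 + norm (ipow r y))"
    using norm_ipow_le[OF assms(2)] by (intro AE_I2) (smt (verit) norm_ge_zero real_norm_def)
qed auto

lemma nat_deriv_char:
  assumes "integrable M (ipow (real n))"
  shows "nat_deriv n (char M) = fourier M (ipow (real n))"
  using assms
proof (induction n)
  case 0
  then show ?case by (simp add: nat_deriv_def char_eq_fourier)
next
  case (Suc n)
  have n: "integrable M (ipow (real n))"
    using Suc.prems by (rule integrable_ipow_mono) auto
  have eq: "ipow (real (Suc n)) = (\<lambda>y. \<i> * of_real y * ipow (real n) y)"
    unfolding ipow_of_nat by (simp add: fun_eq_iff)
  have "integrable M (\<lambda>y. (- \<i>) * ipow (real (Suc n)) y)"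
    using Suc.prems by (intro integrable_mult_right) auto
  then have "integrable M (\<lambda>y. of_real y * ipow (real n) y)"
    unfolding eq by (simp add: mult.assoc)
  then have "vector_derivative (fourier M (ipow (real n))) (at t) = fourier M (ipow (real (Suc n))) t" for t
    unfolding eq by (intro vector_derivative_at has_vector_derivative_fourier n)
  then have "(\<lambda>t. vector_derivative (fourier M (ipow (real n))) (at t)) = fourier M (ipow (real (Suc n)))"
    by (rule ext)
  then show ?case using Suc.IH[OF n] by (simp add: nat_deriv_def)
qed

lemma pos_frac_deriv_char:
  assumes r: "integrable M (ipow (real n + l))" and l: "0 < l" "l < 1"
  shows "pos_frac_deriv n l (char M) = fourier M (ipow (real n + l))"
proof
  fix t
  have n: "integrable M (ipow (real n))"
    by (rule integrable_ipow_mono[OF r]) (use l in auto)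
  \<comment> \<open>Since \<open>l > 0\<close>, both sides vanish at \<open>y = 0\<close>, and
    exponents add everywhere.\<close>
  have eq: "ipow (real n) y * ipow l y = ipow (real n + l) y" for y
    using l by (cases "y = 0") (auto simp: ipow_add ipow_0_right)
  have "norm (ipow (real n) y) * \<bar>y\<bar> powr l = norm (ipow (real n + l) y)" for y
    unfolding eq[symmetric] norm_mult using l by (simp add: norm_ipow[of l])
  then have "integrable M (\<lambda>y. norm (ipow (real n) y) * \<bar>y\<bar> powr l)"
    using r by simp
  from fourier_Marchaud[OF l n this]
  show "pos_frac_deriv n l (char M) t = fourier M (ipow (real n + l)) t"
    unfolding pos_frac_deriv_def nat_deriv_char[OF n] eq .
qed

section \<open>Negative orders\<close>

lemma neg_frac_deriv_fourier:
  assumes r: "integrable M (ipow (s - real n))" and s: "-1 < s" "s < 0" and ae: "AE y in M. y \<noteq> 0"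
  shows "neg_frac_deriv s (fourier M (ipow (- real n))) = fourier M (ipow (s - real n))"
proof
  fix t
  have n: "integrable M (ipow (- real n))"
    by (rule integrable_ipow_mono[OF r]) (use s in auto)
  have eq: "ipow (- real n) y * ipow s y = ipow (s - real n) y" if "y \<noteq> 0" for y
    using ipow_add[OF that, of "- real n" s] by (simp add: algebra_simps)
  have "integrable M (\<lambda>y. norm (ipow (- real n) y) * \<bar>y\<bar> powr s)"
  proof (rule integrable_cong_AE_imp[OF integrable_norm[OF r]])
    show "AE y in M. norm (ipow (s - real n) y) = norm (ipow (- real n) y) * \<bar>y\<bar> powr s"
      using ae by eventually_elim (simp add: eq[symmetric] norm_mult norm_ipow[of s])
  qed auto
  then have "neg_frac_deriv s (fourier M (ipow (- real n))) t = fourier M (\<lambda>y. ipow (- real n) y * ipow s y) t"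
    by (intro fourier_Weyl s ae n)
  also have "\<dots> = fourier M (ipow (s - real n)) t"
    unfolding fourier_def
  proof (rule integral_cong_AE)
    show "AE y in M. ipow (- real n) y * ipow s y * iexp (t * y) = ipow (s - real n) y * iexp (t * y)"
      using ae by eventually_elim (simp add: eq)
  qed auto
  finally show "neg_frac_deriv s (fourier M (ipow (- real n))) t = fourier M (ipow (s - real n)) t" .
qed

text \<open>Induction on \<open>n\<close>. For \<open>q\<close> just above \<open>- (n + 1)\<close>
  the order \<open>q + n\<close> lies in \<open>(-1, 0)\<close> and acts on the derivative of order
  \<open>- n\<close>, giving the density \<open>ipow q\<close>. Letting \<open>q\<close> decrease to
  \<open>- (n + 1)\<close> is dominated by one plus the norm of the limiting density.\<close>

lemma neg_int_deriv_char:
  assumes "integrable M (ipow (- real n))" and ae: "AE y in M. y \<noteq> 0"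
  shows "neg_int_deriv n (char M) = fourier M (ipow (- real n))"
  using assms(1)
proof (induction n)
  case 0
  then show ?case by (simp add: char_eq_fourier)
next
  case (Suc n)
  have n: "integrable M (ipow (- real n))"
    using Suc.prems by (rule integrable_ipow_mono) auto
  show ?case
  proof
    fix t
    have eq: "neg_frac_deriv (q + real n) (neg_int_deriv n (char M)) t = fourier M (ipow q) t"
      if "q \<in> {- real (Suc n)<..<- real n}" for q
    proof -
      have "integrable M (ipow q)"
        using Suc.prems by (rule integrable_ipow_mono) (use that in auto)
      then show ?thesis
        using neg_frac_deriv_fourier[of "q + real n" n] that ae unfolding Suc.IH[OF n] by simp
    qed
    have "((\<lambda>q. LINT y|M. ipow q y * iexp (t * y)) \<longlongrightarrow> (LINT y|M. ipow (- real (Suc n)) y * iexp (t * y)))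
        (at (- real (Suc n)) within {- real (Suc n)<..<- real n})"
    proof (rule integral_dominated_convergence_at[where w = "\<lambda>y. 1 + norm (ipow (- real (Suc n)) y)"])
      show "AE y in M. ((\<lambda>q. ipow q y * iexp (t * y)) \<longlongrightarrow> ipow (- real (Suc n)) y * iexp (t * y))
          (at (- real (Suc n)) within {- real (Suc n)<..<- real n})"
        using ae
      proof eventually_elim
        case (elim y)
        then have "((\<lambda>q. of_real (\<bar>y\<bar> powr q) * cis (sgn y * (pi * q / 2))) \<longlongrightarrow>
            of_real (\<bar>y\<bar> powr (- real (Suc n))) * cis (sgn y * (pi * (- real (Suc n)) / 2)))
          (at (- real (Suc n)) within {- real (Suc n)<..<- real n})"
          unfolding cis_conv_exp by (intro tendsto_intros) auto
        then have "((\<lambda>q. ipow q y) \<longlongrightarrow> ipow (- real (Suc n)) y) (at (- real (Suc n)) within {- real (Suc n)<..<- real n})"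
          using elim unfolding ipow_def by simp
        then show ?case by (intro tendsto_intros)
      qed
      show "AE y in M. norm (ipow q y * iexp (t * y)) \<le> 1 + norm (ipow (- real (Suc n)) y)"
        if "q \<in> {- real (Suc n)<..<- real n}" for q
        using that norm_ipow_le[of q "- real (Suc n)"] by (intro AE_I2) (auto simp: norm_mult)
    qed (use Suc.prems in auto)
    \<comment> \<open>Right neighbourhoods of \<open>- (n + 1)\<close> may be cut off at
      \<open>- n\<close> without changing the limit.\<close>
    then have "((\<lambda>q. fourier M (ipow q) t) \<longlongrightarrow> fourier M (ipow (- real (Suc n))) t) (at_right (- real (Suc n)))"
      unfolding fourier_def
      by (subst at_within_nhd[where S = "{..<- real n}" and U = "{- real (Suc n)<..<- real n}"]) auto
    moreover have "\<forall>\<^sub>F q in at_right (- real (Suc n)). fourier M (ipow q) t = neg_frac_deriv (q + real n) (neg_int_deriv n (char M)) t"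
      using eventually_at_right_real[of "- real (Suc n)" "- real n"] by (auto elim!: eventually_mono simp: eq)
    ultimately have "((\<lambda>q. neg_frac_deriv (q + real n) (neg_int_deriv n (char M)) t) \<longlongrightarrow> fourier M (ipow (- real (Suc n))) t) (at_right (- real (Suc n)))"
      by (rule Lim_transform_eventually)
    then show "neg_int_deriv (Suc n) (char M) t = fourier M (ipow (- real (Suc n))) t"
      unfolding neg_int_deriv.simps by (intro tendsto_Lim) auto
  qed
qed

text \<open>Each branch of \<open>frac_deriv\<close> is a preceding case. For a noninteger
  \<open>r < 0\<close> the intermediate order \<open>\<lceil>r\<rceil>\<close> lies between
  \<open>r\<close> and \<open>0\<close>, so its moment is finite by monotonicity.\<close>

theorem frac_deriv_char:
  assumes r: "integrable M (ipow r)" and ae: "r < 0 \<Longrightarrow> AE y in M. y \<noteq> 0"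
  shows "frac_deriv r (char M) = fourier M (ipow r)"
proof (cases "r \<in> \<int>")
  case True
  then obtain k where k: "r = of_int k" by (auto elim: Ints_cases)
  show ?thesis
  proof (cases "0 \<le> r")
    case True
    then have "r = real (nat k)" using k by simp
    with True k r nat_deriv_char[of "nat k"] show ?thesis by (simp add: frac_deriv_def)
  next
    case False
    then have "r = - real (nat (- k))" using k by simp
    with False k r ae neg_int_deriv_char[of "nat (- k)"] show ?thesis by (simp add: frac_deriv_def)
  qed
next
  case False
  show ?thesis
  proof (cases "0 \<le> r")
    case True
    define l where "l = r - of_int \<lfloor>r\<rfloor>"
    have "of_int \<lfloor>r\<rfloor> \<noteq> r" using False by (metis Ints_of_int)
    then have l: "0 < l" "l < 1" unfolding l_def by linarith+
    have "r = real (nat \<lfloor>r\<rfloor>) + l" using True by (simp add: l_def)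
    with True False l r pos_frac_deriv_char[of "nat \<lfloor>r\<rfloor>" l] show ?thesis
      by (simp add: frac_deriv_def l_def)
  next
    case neg: False
    define n where "n = nat (- \<lceil>r\<rceil>)"
    have n: "of_int \<lceil>r\<rceil> = - real n" using neg by (simp add: n_def)
    have "of_int \<lceil>r\<rceil> \<noteq> r" using False by (metis Ints_of_int)
    then have s: "-1 < r - of_int \<lceil>r\<rceil>" "r - of_int \<lceil>r\<rceil> < 0" by linarith+
    have "integrable M (ipow (- real n))"
      by (rule integrable_ipow_mono[OF r]) (use s n in auto)
    then have "neg_int_deriv n (char M) = fourier M (ipow (- real n))"
      using ae neg by (intro neg_int_deriv_char) auto
    moreover have "neg_frac_deriv (r - of_int \<lceil>r\<rceil>) (fourier M (ipow (- real n))) = fourier M (ipow (r - of_int \<lceil>r\<rceil> - real n))"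
      using ae neg s r by (intro neg_frac_deriv_fourier) (auto simp: n)
    ultimately show ?thesis using neg False by (simp add: frac_deriv_def n n_def[symmetric])
  qed
qed

end

section \<open>Symmetric differences and the sine integral\<close>

lemma diff_op_funpow:
  "(diff_op v ^^ n) \<psi> z = (\<Sum>j\<le>n. (- 1) ^ j * of_nat (n choose j) * \<psi> (z + (real n - 2 * real j) * v))"
proof (induction n arbitrary: z)
  case (Suc n)
  define h where "h = (\<lambda>j. \<psi> (z + (real (Suc n) - 2 * real j) * v))"
  have "(diff_op v ^^ Suc n) \<psi> z = (diff_op v ^^ n) \<psi> (z + v) - (diff_op v ^^ n) \<psi> (z - v)"
    by (simp add: diff_op_def)
  also have "(diff_op v ^^ n) \<psi> (z + v) = (\<Sum>j\<le>n. (- 1) ^ j * of_nat (n choose j) * h j)"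
    unfolding Suc h_def by (intro sum.cong refl) (simp add: algebra_simps)
  \<comment> \<open>The added term has binomial coefficient \<open>0\<close>; after an index shift
    Pascal's rule merges the two sums.\<close>
  also have "\<dots> = (\<Sum>j\<le>Suc n. (- 1) ^ j * of_nat (n choose j) * h j)"
    by simp
  also have "(diff_op v ^^ n) \<psi> (z - v) = (\<Sum>j\<le>n. (- 1) ^ j * of_nat (n choose j) * h (Suc j))"
    unfolding Suc h_def by (intro sum.cong refl) (simp add: algebra_simps)
  also have "(\<Sum>j\<le>Suc n. (- 1) ^ j * of_nat (n choose j) * h j) - (\<Sum>j\<le>n. (- 1) ^ j * of_nat (n choose j) * h (Suc j))
     = (\<Sum>j\<le>Suc n. (- 1) ^ j * of_nat (Suc n choose j) * h j)"
    unfolding sum.atMost_Suc_shift by (simp add: algebra_simps sum.distrib sum_subtractf sum_negf)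
  finally show ?case unfolding h_def .
qed simp

text \<open>As the order is odd, the terms \<open>j\<close> and \<open>2 * m + 1 - j\<close> have
  opposite signs, equal binomials and opposite arguments, so they pair up.\<close>

lemma diff_op_funpow_odd:
  "(diff_op t ^^ (2 * m + 1)) \<psi> 0 =
    (\<Sum>j\<le>m. (- 1) ^ j * of_nat ((2 * m + 1) choose j) *
      (\<psi> (real (2 * m + 1 - 2 * j) * t) - \<psi> (- (real (2 * m + 1 - 2 * j) * t))))"
proof -
  define n where "n = 2 * m + 1"
  define a where "a = (\<lambda>j. (- 1) ^ j * of_nat (n choose j) * \<psi> ((real n - 2 * real j) * t))"
  have "(diff_op t ^^ n) \<psi> 0 = (\<Sum>j\<le>n. a j)"
    unfolding diff_op_funpow a_def by simp
  also have "{..n} = {..m} \<union> {m<..n}" unfolding n_def by auto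
  also have "sum a ({..m} \<union> {m<..n}) = (\<Sum>j\<le>m. a j) + (\<Sum>j\<in>{m<..n}. a j)"
    by (intro sum.union_disjoint) auto
  also have "(\<Sum>j\<in>{m<..n}. a j) = (\<Sum>j\<le>m. a (n - j))"
    by (rule sum.reindex_bij_witness[of _ "\<lambda>j. n - j" "\<lambda>j. n - j"]) (auto simp: n_def)
  also have "(\<Sum>j\<le>m. a j) + (\<Sum>j\<le>m. a (n - j)) = (\<Sum>j\<le>m. a j + a (n - j))"
    by (rule sum.distrib[symmetric])
  also have "\<dots> = (\<Sum>j\<le>m. (- 1) ^ j * of_nat (n choose j) *
      (\<psi> (real (n - 2 * j) * t) - \<psi> (- (real (n - 2 * j) * t))))"
  proof (intro sum.cong refl)
    fix j assume "j \<in> {..m}"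
    then have j: "j \<le> m" by simp
    have e1: "(- 1 :: complex) ^ (n - j) = - ((- 1) ^ j)"
      using j by (simp add: n_def uminus_power_if)
    have e2: "n choose (n - j) = n choose j"
      using j binomial_symmetric[of j n] by (simp add: n_def)
    have e3: "real n - 2 * real j = real (n - 2 * j)" and e4: "real n - 2 * real (n - j) = - real (n - 2 * j)"
      using j by (auto simp: n_def)
    show "a j + a (n - j) = (- 1) ^ j * of_nat (n choose j) *
      (\<psi> (real (n - 2 * j) * t) - \<psi> (- (real (n - 2 * j) * t)))"
      unfolding a_def e1 e2 e3 e4 by (simp only: mult_minus_left right_diff_distrib add_uminus_conv_diff)
  qed
  finally show ?thesis unfolding n_def .
qed

text \<open>By Pascal's rule the alternating sum of row \<open>N\<close> up to \<open>m\<close>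
  telescopes to \<open>(- 1) ^ m\<close> times \<open>(N - 1) choose m\<close>; here
  \<open>N = 2 * m + 1\<close>.\<close>

lemma alternating_partial_binomial_sum:
  "(\<Sum>j\<le>m. (- 1) ^ j * of_nat ((2 * m + 1) choose j)) = ((- 1) ^ m * of_nat ((2 * m) choose m) :: complex)"
  using gbinomial_sum_lower_neg[of "of_nat (2 * m + 1) :: complex" m]
  by (simp only: binomial_gbinomial mult.commute[of "(- 1) ^ _"]) simp

section \<open>Linearity and uniqueness of the improper integral\<close>

text \<open>Identities available only for \<open>0 < \<epsilon> < T\<close> may thereby be used
  under the joint limit.\<close>

lemma eventually_at_right_0_times_at_top:
  "\<forall>\<^sub>F p in at_right 0 \<times>\<^sub>F at_top. 0 < fst p \<and> fst p < (snd p :: real)"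
proof -
  have "\<forall>\<^sub>F \<epsilon> in at_right (0::real). 0 < \<epsilon> \<and> \<epsilon> < 1"
    using eventually_at_right_real[of 0 "1::real"] by simp
  moreover have "\<forall>\<^sub>F T in at_top. (1::real) < T"
    by (rule eventually_gt_at_top)
  ultimately show ?thesis
    unfolding eventually_prod_filter by fastforce
qed

lemma has_improper_integral_cmult:
  assumes "has_improper_integral g J"
  shows "has_improper_integral (\<lambda>t. c * g t) (c * J)"
  unfolding has_improper_integral_def
proof (intro conjI allI impI)
  have "((\<lambda>p. c * (case p of (\<epsilon>, T) \<Rightarrow> LINT t:{\<epsilon>..T}|lborel. g t)) \<longlongrightarrow> c * J) (at_right 0 \<times>\<^sub>F at_top)"
    using assms unfolding has_improper_integral_def by (intro tendsto_mult_left) blast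
  then show "((\<lambda>(\<epsilon>, T). LINT t:{\<epsilon>..T}|lborel. c * g t) \<longlongrightarrow> c * J) (at_right 0 \<times>\<^sub>F at_top)"
    by (simp add: case_prod_unfold)
qed (use assms in \<open>auto simp: has_improper_integral_def\<close>)

lemma has_improper_integral_add:
  assumes "has_improper_integral g J" "has_improper_integral h K"
  shows "has_improper_integral (\<lambda>t. g t + h t) (J + K)"
  unfolding has_improper_integral_def
proof (intro conjI allI impI)
  have int: "set_integrable lborel {\<epsilon>..T} g" "set_integrable lborel {\<epsilon>..T} h" if "0 < \<epsilon>" "\<epsilon> < T" for \<epsilon> T
    using assms that by (auto simp: has_improper_integral_def)
  then show "set_integrable lborel {\<epsilon>..T} (\<lambda>t. g t + h t)" if "0 < \<epsilon>" "\<epsilon> < T" for \<epsilon> T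
    using that by (intro set_integral_add)
  have "((\<lambda>p. (case p of (\<epsilon>, T) \<Rightarrow> LINT t:{\<epsilon>..T}|lborel. g t) + (case p of (\<epsilon>, T) \<Rightarrow> LINT t:{\<epsilon>..T}|lborel. h t))
      \<longlongrightarrow> J + K) (at_right 0 \<times>\<^sub>F at_top)"
    using assms unfolding has_improper_integral_def by (intro tendsto_add) blast+
  then show "((\<lambda>(\<epsilon>, T). LINT t:{\<epsilon>..T}|lborel. g t + h t) \<longlongrightarrow> J + K) (at_right 0 \<times>\<^sub>F at_top)"
  proof (rule Lim_transform_eventually)
    show "\<forall>\<^sub>F p in at_right 0 \<times>\<^sub>F at_top.
        (case p of (\<epsilon>, T) \<Rightarrow> LINT t:{\<epsilon>..T}|lborel. g t) + (case p of (\<epsilon>, T) \<Rightarrow> LINT t:{\<epsilon>..T}|lborel. h t)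
      = (case p of (\<epsilon>, T) \<Rightarrow> LINT t:{\<epsilon>..T}|lborel. g t + h t)"
      using eventually_at_right_0_times_at_top by eventually_elim (auto simp: set_integral_add(2) int)
  qed
qed

lemma has_improper_integral_sum:
  assumes "finite A" "\<And>j. j \<in> A \<Longrightarrow> has_improper_integral (g j) (J j)"
  shows "has_improper_integral (\<lambda>t. \<Sum>j\<in>A. g j t) (\<Sum>j\<in>A. J j)"
  using assms
proof (induction A rule: finite_induct)
  case empty
  show ?case by (simp add: has_improper_integral_def set_integrable_def case_prod_unfold)
qed (simp add: has_improper_integral_add)

lemma improper_integral_unique:
  assumes "has_improper_integral g J"
  shows "improper_integral g = J"
  unfolding improper_integral_def
proof (rule the_equality)
  show "has_improper_integral g J" by fact
next
  fix K assume "has_improper_integral g K"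
  moreover have "at_right (0::real) \<times>\<^sub>F (at_top :: real filter) \<noteq> bot"
    by (simp add: prod_filter_eq_bot)
  ultimately show "K = J" using assms
    unfolding has_improper_integral_def by (meson tendsto_unique)
qed

section \<open>The sine integral and the sign function\<close>

text \<open>The antiderivative is \<open>Si (t * \<theta>)\<close>, with the sign pulled out of the
  odd function \<open>Si\<close> so that its limit \<open>pi / 2\<close> at infinity serves both
  signs of \<open>\<theta>\<close>.\<close>

lemma set_integral_sin_over:
  fixes \<theta> \<epsilon> T :: real
  assumes "0 < \<epsilon>" "\<epsilon> \<le> T"
  shows "(LINT t:{\<epsilon>..T}|lborel. sin (t * \<theta>) / t) = sgn \<theta> * Si (T * \<bar>\<theta>\<bar>) - sgn \<theta> * Si (\<epsilon> * \<bar>\<theta>\<bar>)"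
proof -
  have "((\<lambda>t. sin (t * \<theta>) / t) has_integral (sgn \<theta> * Si (T * \<bar>\<theta>\<bar>) - sgn \<theta> * Si (\<epsilon> * \<bar>\<theta>\<bar>))) {\<epsilon>..T}"
  proof (rule fundamental_theorem_of_calculus)
    fix t assume t: "t \<in> {\<epsilon>..T}"
    have "((\<lambda>t. sgn \<theta> * Si (t * \<bar>\<theta>\<bar>)) has_real_derivative sgn \<theta> * (sinc (t * \<bar>\<theta>\<bar>) * \<bar>\<theta>\<bar>)) (at t within {\<epsilon>..T})"
      by (auto intro!: derivative_eq_intros DERIV_chain2[OF DERIV_Si])
    also have "sgn \<theta> * (sinc (t * \<bar>\<theta>\<bar>) * \<bar>\<theta>\<bar>) = sin (t * \<theta>) / t"
    proof (cases "\<theta> = 0")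
      case False
      have "sgn \<theta> * sin (t * \<bar>\<theta>\<bar>) = sin (t * \<theta>)"
        using False by (cases "\<theta> > 0") simp_all
      with False t assms show ?thesis by simp
    qed simp
    finally show "((\<lambda>t. sgn \<theta> * Si (t * \<bar>\<theta>\<bar>)) has_vector_derivative sin (t * \<theta>) / t) (at t within {\<epsilon>..T})"
      by (simp add: has_real_derivative_iff_has_vector_derivative)
  qed (use assms in auto)
  moreover have "set_integrable lborel {\<epsilon>..T} (\<lambda>t. sin (t * \<theta>) / t)"
    using assms by (intro borel_integrable_atLeastAtMost' continuous_intros) auto
  ultimately show ?thesis
    by (metis integral_unique set_borel_integral_eq_integral(2))
qed

lemma iexp_diff_eq_sin: "iexp a - iexp (- a) = 2 * \<i> * of_real (sin a)"
  by (simp add: complex_eq_iff Re_exp Im_exp)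

context real_distribution
begin

text \<open>\<open>G (k * t) - G (- (k * t))\<close> is a mixture of
  \<open>sin (t * (k * (y - x)))\<close>, so Fubini on \<open>{\<epsilon>..T}\<close> leaves a
  mixture of sine integrals, whose limits do not depend on \<open>k > 0\<close>.\<close>

lemma has_improper_integral_fourier_sgn:
  fixes x :: real
  assumes g: "integrable M g" and k: "k > 0"
  defines "G \<equiv> \<lambda>t. LINT y|M. g y * iexp (t * (y - x))"
  shows "has_improper_integral (\<lambda>t. (G (k * t) - G (- (k * t))) / of_real t)
     (\<i> * pi * (LINT y|M. g y * of_real (sgn (y - x))))"
proof -
  have [measurable]: "g \<in> borel_measurable M" using g by auto
  interpret P: pair_sigma_finite M lborel ..
  \<comment> \<open>\<open>A\<close> plays the role of an antiderivative: the truncated integral is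
    \<open>A T - A \<epsilon>\<close>, which splits the joint limit into two separate ones.\<close>
  define A where "A = (\<lambda>T. LINT y|M. g y * (2 * \<i> * of_real (sgn (y - x) * Si (T * (k * \<bar>y - x\<bar>)))))"
  obtain B where B: "\<And>T. \<bar>Si T\<bar> \<le> B" using bounded_Si by blast
  have B0: "B \<ge> 0" using B[of 0] by linarith
  have bnd: "norm (g y * (2 * \<i> * of_real (sgn (y - x) * Si T))) \<le> 2 * B * norm (g y)" for y T
  proof -
    have "\<bar>sgn (y - x) * Si T\<bar> \<le> 1 * B"
      unfolding abs_mult using B[of T] by (intro mult_mono) (auto simp: abs_sgn_eq)
    from mult_left_mono[OF this norm_ge_zero[of "g y"]] show ?thesis
      unfolding norm_mult norm_of_real by (simp add: mult.commute[of B])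
  qed
  have Aint: "integrable M (\<lambda>y. g y * (2 * \<i> * of_real (sgn (y - x) * Si (T * (k * \<bar>y - x\<bar>)))))" for T
    by (rule Bochner_Integration.integrable_bound[where f = "\<lambda>y. 2 * B * norm (g y)"])
      (use g bnd B0 in \<open>auto intro!: AE_I2 simp: abs_mult\<close>)
  have Gd: "G (k * t) - G (- (k * t)) = (LINT y|M. g y * (2 * \<i> * of_real (sin (t * (k * (y - x))))))" for t
  proof -
    have int: "integrable M (\<lambda>y. g y * iexp (s * (y - x)))" for s
      by (rule Bochner_Integration.integrable_bound[OF g]) (auto simp: norm_mult)
    have "G (k * t) - G (- (k * t)) = (LINT y|M. g y * iexp (k * t * (y - x)) - g y * iexp (- (k * t) * (y - x)))"
      unfolding G_def by (intro Bochner_Integration.integral_diff[symmetric] int)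
    also have "\<dots> = (LINT y|M. g y * (iexp (t * (k * (y - x))) - iexp (- (t * (k * (y - x))))))"
      by (intro Bochner_Integration.integral_cong refl) (simp add: algebra_simps)
    finally show ?thesis unfolding iexp_diff_eq_sin .
  qed
  have key: "set_integrable lborel {\<epsilon>..T} (\<lambda>t. (G (k * t) - G (- (k * t))) / of_real t) \<and>
     (LINT t:{\<epsilon>..T}|lborel. (G (k * t) - G (- (k * t))) / of_real t) = A T - A \<epsilon>"
    if \<epsilon>: "0 < \<epsilon>" "\<epsilon> < T" for \<epsilon> T
  proof -
    define F where "F = (\<lambda>y t. g y * (2 * \<i> * of_real (indicator {\<epsilon>..T} t *\<^sub>R (sin (t * (k * (y - x))) / t))))"
    \<comment> \<open>With \<open>\<bar>sin\<bar> \<le> 1\<close> and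
      \<open>t \<ge> \<epsilon>\<close> the integrand has this product majorant.\<close>
    have "integrable (M \<Otimes>\<^sub>M lborel) (\<lambda>(y, t). norm (g y) * (2 / \<epsilon> * indicator {\<epsilon>..T} t))"
    proof (rule P.Fubini_integrable)
      show "integrable M (\<lambda>y. LINT t|lborel. norm (case (y, t) of (y, t) \<Rightarrow> norm (g y) * (2 / \<epsilon> * indicator {\<epsilon>..T} t)))"
        using g \<epsilon> by (simp add: abs_mult)
    qed (use \<epsilon> in \<open>auto simp: emeasure_lborel_Icc_eq\<close>)
    then have F: "integrable (M \<Otimes>\<^sub>M lborel) (case_prod F)"
    proof (rule Bochner_Integration.integrable_bound)
      show "case_prod F \<in> borel_measurable (M \<Otimes>\<^sub>M lborel)"
        unfolding F_def by measurable
      have "norm (F y t) \<le> norm (g y) * (2 / \<epsilon> * indicator {\<epsilon>..T} t)" for y t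
      proof (cases "t \<in> {\<epsilon>..T}")
        case True
        have "\<bar>sin (t * (k * (y - x))) / t\<bar> \<le> 1 / \<epsilon>"
          unfolding abs_divide using True \<epsilon> by (intro frac_le) auto
        then have "norm (g y) * (2 * \<bar>sin (t * (k * (y - x))) / t\<bar>) \<le> norm (g y) * (2 * (1 / \<epsilon>))"
          by (intro mult_left_mono) auto
        then show ?thesis using True unfolding F_def norm_mult norm_of_real by simp
      qed (simp add: F_def)
      then show "AE p in M \<Otimes>\<^sub>M lborel. norm (case_prod F p) \<le> norm (case p of (y, t) \<Rightarrow> norm (g y) * (2 / \<epsilon> * indicator {\<epsilon>..T} t))"
        by (intro AE_I2) (auto intro: order_trans[OF _ abs_ge_self])
    qed
    have 1: "(\<lambda>t. LINT y|M. F y t) = (\<lambda>t. indicator {\<epsilon>..T} t *\<^sub>R ((G (k * t) - G (- (k * t))) / of_real t))"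
    proof
      fix t
      have "(LINT y|M. F y t) = (LINT y|M. (g y * (2 * \<i> * of_real (sin (t * (k * (y - x)))))) * of_real (indicator {\<epsilon>..T} t / t))"
        unfolding F_def by (intro Bochner_Integration.integral_cong refl) simp
      also have "\<dots> = (G (k * t) - G (- (k * t))) * of_real (indicator {\<epsilon>..T} t / t)"
        unfolding Gd by (rule integral_mult_left_zero)
      finally show "(LINT y|M. F y t) = indicator {\<epsilon>..T} t *\<^sub>R ((G (k * t) - G (- (k * t))) / of_real t)"
        by (simp add: scaleR_conv_of_real)
    qed
    have 2: "(LINT t|lborel. F y t) = g y * (2 * \<i> * of_real (sgn (y - x) * Si (T * (k * \<bar>y - x\<bar>))))
       - g y * (2 * \<i> * of_real (sgn (y - x) * Si (\<epsilon> * (k * \<bar>y - x\<bar>))))" for y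
    proof -
      have "(LINT t|lborel. F y t) = g y * (2 * \<i> * of_real (LINT t:{\<epsilon>..T}|lborel. sin (t * (k * (y - x))) / t))"
        unfolding F_def set_lebesgue_integral_def integral_mult_right_zero integral_complex_of_real ..
      also have "(LINT t:{\<epsilon>..T}|lborel. sin (t * (k * (y - x))) / t)
          = sgn (y - x) * Si (T * (k * \<bar>y - x\<bar>)) - sgn (y - x) * Si (\<epsilon> * (k * \<bar>y - x\<bar>))"
        using \<epsilon> k by (subst set_integral_sin_over) (auto simp: abs_mult sgn_mult)
      finally show ?thesis by (simp add: algebra_simps)
    qed
    have "set_integrable lborel {\<epsilon>..T} (\<lambda>t. (G (k * t) - G (- (k * t))) / of_real t)"
      unfolding set_integrable_def 1[symmetric] using F by (rule P.integrable_snd)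
    moreover have "(LINT t:{\<epsilon>..T}|lborel. (G (k * t) - G (- (k * t))) / of_real t) = A T - A \<epsilon>"
      unfolding set_lebesgue_integral_def 1[symmetric] P.Fubini_integral[OF F] 2 A_def
      by (intro Bochner_Integration.integral_diff Aint)
    ultimately show ?thesis by blast
  qed
  have "(A \<longlongrightarrow> (LINT y|M. g y * (2 * \<i> * of_real (sgn (y - x) * (pi / 2))))) at_top"
    unfolding A_def
  proof (rule integral_dominated_convergence_at_top[where w = "\<lambda>y. 2 * B * norm (g y)"])
    show "AE y in M. ((\<lambda>T. g y * (2 * \<i> * of_real (sgn (y - x) * Si (T * (k * \<bar>y - x\<bar>)))))
       \<longlongrightarrow> g y * (2 * \<i> * of_real (sgn (y - x) * (pi / 2)))) at_top"
    proof (rule AE_I2)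
      fix y
      show "((\<lambda>T. g y * (2 * \<i> * of_real (sgn (y - x) * Si (T * (k * \<bar>y - x\<bar>)))))
         \<longlongrightarrow> g y * (2 * \<i> * of_real (sgn (y - x) * (pi / 2)))) at_top"
      \<comment> \<open>At \<open>y = x\<close> the sign is \<open>0\<close>; this is the origin of
        the weight one half at \<open>X = x\<close>.\<close>
      proof (cases "y = x")
        case False
        then have "LIM T at_top. T * (k * \<bar>y - x\<bar>) :> at_top"
          using k by (intro filterlim_at_top_mult_tendsto_pos[OF tendsto_const]) (auto intro: filterlim_ident)
        then show ?thesis
          by (intro tendsto_intros filterlim_compose[OF Si_at_top])
      qed auto
    qed
    show "\<forall>\<^sub>F T in at_top. AE y in M. norm (g y * (2 * \<i> * of_real (sgn (y - x) * Si (T * (k * \<bar>y - x\<bar>))))) \<le> 2 * B * norm (g y)"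
      by (rule always_eventually, rule allI, rule AE_I2, rule bnd)
  qed (use g in auto)
  moreover have "(LINT y|M. g y * (2 * \<i> * of_real (sgn (y - x) * (pi / 2)))) = \<i> * pi * (LINT y|M. g y * of_real (sgn (y - x)))"
    unfolding integral_mult_right_zero[symmetric] by (intro Bochner_Integration.integral_cong refl) simp
  ultimately have top: "(A \<longlongrightarrow> \<i> * pi * (LINT y|M. g y * of_real (sgn (y - x)))) at_top" by simp
  \<comment> \<open>The lower cut-off contributes nothing, because \<open>Si\<close> is continuous
    with \<open>Si 0 = 0\<close>; the factor \<open>0\<close> stands for that value.\<close>
  have "(A \<longlongrightarrow> (LINT y|M. g y * (2 * \<i> * of_real (sgn (y - x) * 0)))) (at_right 0)"
    unfolding A_def
  proof (rule integral_dominated_convergence_at[where w = "\<lambda>y. 2 * B * norm (g y)"])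
    show "AE y in M. ((\<lambda>T. g y * (2 * \<i> * of_real (sgn (y - x) * Si (T * (k * \<bar>y - x\<bar>)))))
       \<longlongrightarrow> g y * (2 * \<i> * of_real (sgn (y - x) * 0))) (at_right 0)"
    proof (rule AE_I2)
      fix y
      have "((\<lambda>T. T * (k * \<bar>y - x\<bar>)) \<longlongrightarrow> 0) (at_right 0)"
        by (auto intro!: tendsto_eq_intros)
      then have "((\<lambda>T. Si (T * (k * \<bar>y - x\<bar>))) \<longlongrightarrow> Si 0) (at_right 0)"
        by (rule isCont_tendsto_compose[OF isCont_Si])
      moreover have "Si 0 = 0" using Si_neg[of 0] by simp
      ultimately show "((\<lambda>T. g y * (2 * \<i> * of_real (sgn (y - x) * Si (T * (k * \<bar>y - x\<bar>)))))
         \<longlongrightarrow> g y * (2 * \<i> * of_real (sgn (y - x) * 0))) (at_right 0)"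
        by (intro tendsto_intros) simp
    qed
    show "AE y in M. norm (g y * (2 * \<i> * of_real (sgn (y - x) * Si (h * (k * \<bar>y - x\<bar>))))) \<le> 2 * B * norm (g y)" for h
      by (rule AE_I2, rule bnd)
  qed (use g in auto)
  then have bot: "(A \<longlongrightarrow> 0) (at_right 0)" by simp
  have "((\<lambda>p. A (snd p) - A (fst p)) \<longlongrightarrow> \<i> * pi * (LINT y|M. g y * of_real (sgn (y - x))) - 0) (at_right 0 \<times>\<^sub>F at_top)"
    by (intro tendsto_diff filterlim_compose[OF top filterlim_snd] filterlim_compose[OF bot filterlim_fst])
  then have "((\<lambda>(\<epsilon>, T). LINT t:{\<epsilon>..T}|lborel. (G (k * t) - G (- (k * t))) / of_real t)
      \<longlongrightarrow> \<i> * pi * (LINT y|M. g y * of_real (sgn (y - x))) - 0) (at_right 0 \<times>\<^sub>F at_top)"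
  proof (rule Lim_transform_eventually)
    show "\<forall>\<^sub>F p in at_right 0 \<times>\<^sub>F at_top. A (snd p) - A (fst p) =
       (case p of (\<epsilon>, T) \<Rightarrow> LINT t:{\<epsilon>..T}|lborel. (G (k * t) - G (- (k * t))) / of_real t)"
      using eventually_at_right_0_times_at_top by eventually_elim (auto simp: key)
  qed
  with key show ?thesis unfolding has_improper_integral_def by simp
qed

text \<open>The phase shifts \<open>y\<close> to \<open>y - x\<close>. Every odd difference then
  contributes the same value, whatever its step \<open>2 * m + 1 - 2 * j\<close>, so the
  coefficients simply add up.\<close>

lemma has_improper_integral_diff_op:
  assumes g: "integrable M g"
  shows "has_improper_integral
     (\<lambda>t. (diff_op t ^^ (2 * m + 1)) (\<lambda>t. exp (- (\<i> * of_real (t * x))) * fourier M g t) 0 / of_real t)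
     (\<i> * pi * (- 1) ^ m * of_nat ((2 * m) choose m) * (LINT y|M. g y * of_real (sgn (y - x))))"
proof -
  define G where "G = (\<lambda>t. LINT y|M. g y * iexp (t * (y - x)))"
  define S where "S = (LINT y|M. g y * of_real (sgn (y - x)))"
  have G: "(\<lambda>t. exp (- (\<i> * of_real (t * x))) * fourier M g t) = G"
  proof
    fix t
    have "exp (- (\<i> * of_real (t * x))) * fourier M g t = (LINT y|M. exp (- (\<i> * of_real (t * x))) * (g y * iexp (t * y)))"
      unfolding fourier_def by (rule integral_mult_right_zero[symmetric])
    also have "\<dots> = G t" unfolding G_def
      by (intro Bochner_Integration.integral_cong refl) (simp add: right_diff_distrib exp_diff exp_minus field_simps)
    finally show "exp (- (\<i> * of_real (t * x))) * fourier M g t = G t" .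
  qed
  have "has_improper_integral (\<lambda>t. \<Sum>j\<le>m. ((- 1) ^ j * of_nat ((2 * m + 1) choose j)) *
      ((G (real (2 * m + 1 - 2 * j) * t) - G (- (real (2 * m + 1 - 2 * j) * t))) / of_real t))
    (\<Sum>j\<le>m. ((- 1) ^ j * of_nat ((2 * m + 1) choose j)) * (\<i> * pi * S))"
    unfolding G_def S_def
    by (intro has_improper_integral_sum has_improper_integral_cmult has_improper_integral_fourier_sgn g) auto
  then show ?thesis
    unfolding G diff_op_funpow_odd sum_distrib_right[symmetric] alternating_partial_binomial_sum S_def
    by (simp add: sum_divide_distrib mult_ac)
qed

end

section \<open>Assembling the two inversion formulas\<close>

theorem corollary3p9:
  fixes M :: "'a measure" and X :: "'a \<Rightarrow> real" and f :: "real \<Rightarrow> complex"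
    and m :: nat and r x :: real
  assumes "prob_space M"
    and "X \<in> borel_measurable M"
    and "f = char (distr M borel X)"
    and "(\<integral>\<^sup>+ \<omega>. abs_pow (X \<omega>) r \<partial>M) < \<infinity>"
  shows "improper_integrable
           (\<lambda>t. (diff_op t ^^ (2 * m + 1)) (shifted_deriv f r x) 0 / of_real t) \<and>
         (LINT \<omega>|M. cnj (cpow (of_real (X \<omega>)) r) *
             (indicator {..<x} (X \<omega>) + 1 / 2 * indicator {x} (X \<omega>)))
           = frac_deriv r f 0 / (2 * cpow \<i> r)
             - (- 1) ^ m / (2 * of_real pi * cpow \<i> (r + 1) * of_nat ((2 * m) choose m))
               * improper_integral
                   (\<lambda>t. (diff_op t ^^ (2 * m + 1)) (shifted_deriv f r x) 0 / of_real t) \<and>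
         (LINT \<omega>|M. cnj (cpow (of_real (X \<omega>)) r) *
             (indicator {x<..} (X \<omega>) + 1 / 2 * indicator {x} (X \<omega>)))
           = frac_deriv r f 0 / (2 * cpow \<i> r)
             + (- 1) ^ m / (2 * of_real pi * cpow \<i> (r + 1) * of_nat ((2 * m) choose m))
               * improper_integral
                   (\<lambda>t. (diff_op t ^^ (2 * m + 1)) (shifted_deriv f r x) 0 / of_real t)"
proof -
  interpret M: prob_space M by fact
  have X[measurable]: "X \<in> borel_measurable M" by fact
  define N where "N = distr M borel X"
  interpret N: real_distribution N unfolding N_def by (rule M.real_distribution_distr) fact
  have [measurable]: "(\<lambda>y. abs_pow y r) \<in> borel_measurable borel"
    unfolding abs_pow_def by measurable
  have fin: "(\<integral>\<^sup>+ y. abs_pow y r \<partial>N) < \<infinity>"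
    using assms(4) by (simp add: N_def nn_integral_distr)
  have int: "integrable N (ipow r)"
  proof (rule integrableI_bounded)
    \<comment> \<open>Only an inequality: for \<open>r < 0\<close> and \<open>y = 0\<close> the left
      integrand is the dummy value \<open>0\<close>, while \<open>abs_pow\<close> is
      infinite.\<close>
    have "(\<integral>\<^sup>+ y. norm (ipow r y) \<partial>N) \<le> (\<integral>\<^sup>+ y. abs_pow y r \<partial>N)"
      by (intro nn_integral_mono) (auto simp: norm_ipow abs_pow_def)
    with fin show "(\<integral>\<^sup>+ y. norm (ipow r y) \<partial>N) < \<infinity>" by (rule order.strict_trans1[rotated])
  qed auto
  \<comment> \<open>Finiteness of the moment forbids mass where \<open>abs_pow\<close> is infinite,
    that is, at \<open>0\<close>.\<close>
  have ae: "AE y in N. y \<noteq> 0" if "r < 0"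
  proof -
    have "AE y in N. abs_pow y r \<noteq> \<infinity>"
      using fin by (intro nn_integral_noteq_infinite) auto
    then show ?thesis by eventually_elim (use that in \<open>auto simp: abs_pow_def\<close>)
  qed
  have fd: "frac_deriv r f = fourier N (ipow r)"
    using N.frac_deriv_char[OF int ae] assms(3) by (simp add: N_def)
  define S where "S = (LINT y|N. ipow r y * of_real (sgn (y - x)))"
  let ?g = "\<lambda>t. (diff_op t ^^ (2 * m + 1)) (shifted_deriv f r x) 0 / of_real t"
  have sd: "shifted_deriv f r x = (\<lambda>t. exp (- (\<i> * of_real (t * x))) * fourier N (ipow r) t)"
    by (simp add: shifted_deriv_def fd fun_eq_iff)
  have J: "has_improper_integral ?g (\<i> * pi * (- 1) ^ m * of_nat ((2 * m) choose m) * S)"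
    unfolding sd S_def by (rule N.has_improper_integral_diff_op[OF int])
  have ci: "cpow \<i> r \<noteq> 0" "cpow \<i> (r + 1) = cpow \<i> r * \<i>"
    by (simp_all add: cpow_ii distrib_left add_divide_distrib cis_mult[symmetric])
  have int_sgn: "integrable N (\<lambda>y. ipow r y * of_real (sgn (y - x)))"
    by (rule Bochner_Integration.integrable_bound[OF int])
      (auto simp: norm_mult abs_sgn_eq intro!: AE_I2)
  \<comment> \<open>One computation for both formulas: with \<open>c = 1\<close> or
    \<open>c = - 1\<close> the factor \<open>(1 + c * sgn (X \<omega> - x)) / 2\<close> is the
    one-sided indicator with weight one half at the tie.\<close>
  have half: "(LINT \<omega>|M. cnj (cpow (of_real (X \<omega>)) r) * of_real ((1 + c * sgn (X \<omega> - x)) / 2))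
      = (frac_deriv r f 0 + of_real c * S) / (2 * cpow \<i> r)" for c :: real
  proof -
    have "cpow \<i> r * (LINT \<omega>|M. cnj (cpow (of_real (X \<omega>)) r) * of_real ((1 + c * sgn (X \<omega> - x)) / 2))
        = (LINT \<omega>|M. ipow r (X \<omega>) * of_real ((1 + c * sgn (X \<omega> - x)) / 2))"
      unfolding integral_mult_right_zero[symmetric] ipow_eq_cpow[symmetric] by (simp only: mult.assoc)
    also have "\<dots> = (LINT y|N. ipow r y * of_real ((1 + c * sgn (y - x)) / 2))"
      unfolding N_def by (rule integral_distr[symmetric]) measurable
    also have "\<dots> = (LINT y|N. 1 / 2 * ipow r y + of_real (c / 2) * (ipow r y * of_real (sgn (y - x))))"
      by (intro Bochner_Integration.integral_cong refl) (simp add: field_simps)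
    also have "\<dots> = 1 / 2 * (LINT y|N. ipow r y) + of_real (c / 2) * S"
      unfolding S_def using int int_sgn by simp
    also have "(LINT y|N. ipow r y) = frac_deriv r f 0"
      unfolding fd fourier_def by simp
    finally have "cpow \<i> r * (LINT \<omega>|M. cnj (cpow (of_real (X \<omega>)) r) * of_real ((1 + c * sgn (X \<omega> - x)) / 2))
        = 1 / 2 * frac_deriv r f 0 + of_real (c / 2) * S" .
    \<comment> \<open>Dividing by \<open>cpow \<i> r\<close> is done for abstract \<open>L\<close>,
      \<open>u\<close>, \<open>w\<close>, so that the integrals stay intact.\<close>
    moreover have "L = (u + of_real c * S) / (2 * w)"
      if "w * L = 1 / 2 * u + of_real (c / 2) * S" "w \<noteq> 0" for L u w :: complex
      using that by (simp add: field_simps)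
    ultimately show ?thesis using ci(1) by blast
  qed
  have pos: "indicator {x<..} y + 1 / 2 * indicator {x} y = (of_real ((1 + 1 * sgn (y - x)) / 2) :: complex)" for y
    by (auto simp: indicator_def sgn_real_def)
  have neg: "indicator {..<x} y + 1 / 2 * indicator {x} y = (of_real ((1 + (- 1) * sgn (y - x)) / 2) :: complex)" for y
    by (auto simp: indicator_def sgn_real_def)
  \<comment> \<open>The sign \<open>(- 1) ^ m\<close> occurs twice and cancels, as do
    \<open>pi\<close>, the binomial and the extra \<open>\<i>\<close> in
    \<open>cpow \<i> (r + 1)\<close>.\<close>
  have "((2 * m) choose m) \<noteq> 0" by simp
  moreover have "(- 1) ^ m * (- 1) ^ m = (1 :: complex)" by (simp flip: power_add mult_2)
  ultimately have *: "(- 1) ^ m / (2 * of_real pi * cpow \<i> (r + 1) * of_nat ((2 * m) choose m)) * improper_integral ?g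
      = S / (2 * cpow \<i> r)"
    unfolding improper_integral_unique[OF J] ci(2) using ci(1) by (simp add: field_simps)
  show ?thesis
    unfolding * pos neg half using J
    by (auto simp: improper_integrable_def add_divide_distrib diff_divide_distrib)
qed

end
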